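(* Let $n\ge 1$. The set $A_n=\{G_\alpha : \alpha\in\{0,1\}^n \text{ breaks the ballot condition}\}$ is a $\mathbb{Q}$-linear basis of the ideal $I_n$.
   Context: Let $R_n=\mathbb{Q}[\theta_1,\dots,\theta_n]$ be the polynomial ring in anticommuting variables over $\mathbb{Q}$ (exterior algebra): $\theta_i\theta_j=-\theta_j\theta_i$ for $i\ne j$, $\theta_i^2=0$. For $A=\{a_1<\cdots<a_r\}\subseteq[n]$ put $\theta_A=\theta_{a_1}\cdots\theta_{a_r}$, and $F_{1^r}=\sum_{A\subseteq[n],|A|=r}\theta_A$ (so $F_{1^0}=1$). Let $I_n$ be the ideal of $R_n$ generated by $F_{1^r}$, $1\le r\le n$. A sequence $\alpha=(a_1,\dots,a_n)\in\{0,1\}^n$ is a ballot sequence if $\sum_{i=1}^r a_i\le r/2$ for all $1\le r\le n$; it breaks the ballot condition (at position $r$) if $\sum_{i=1}^r a_i>r/2$ for some $1\le r\le n$. For a $0$-$1$ string $u$ let $m_1(u)$ be its number of $1$s. For $\alpha\in\{0,1\}^n$ (written as a string) the element $G_\alpha\in R_n$ is defined recursively: $G_{1^s0^{n-s}}=F_{1^s}$ for $0\le s\le n$; otherwise $\alpha$ is uniquely of the form $u01^s0^{n-k-s}$ with $s\ge 1$ and $u$ a string of length $k-1$, and $$G_{u01^s0^{n-k-s}}=G_{u1^s0^{n-k-s+1}}-(-1)^{m_1(u)}\theta_k\,G_{u1^{s-1}0^{n-k-s+2}}.$$ *)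

theory Defs
  imports Complex_Main "HOL-Algebra.Ideal" "HOL-Library.Function_Algebras"
begin

section \<open>The exterior algebra over the rationals\<close>

text \<open>
  An element of the exterior algebra on generators indexed by the natural numbers is given by its
  coefficient function: \<open>f A\<close> is the coefficient of the monomial \<open>\<theta>\<^sub>A\<close>.  Addition is
  the pointwise one of \<open>HOL-Library.Function_Algebras\<close>.  The pointwise product \<open>*\<close> of that
  theory is never used; the product of the exterior algebra is \<open>\<^bold>*\<close>.
\<close>

type_synonym ext = "nat set \<Rightarrow> rat"

definition ext_scale :: "rat \<Rightarrow> ext \<Rightarrow> ext" (infixr \<open>*\<^sub>Q\<close> 75) where
  "c *\<^sub>Q f = (\<lambda>A. c * f A)"

interpretation ext: vector_space ext_scale
  by unfold_locales (auto simp: ext_scale_def fun_eq_iff algebra_simps)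

text \<open>For disjoint \<open>A\<close> and \<open>B\<close> one has \<open>\<theta>\<^sub>A \<theta>\<^sub>B = \<epsilon>(A,B) \<theta>\<^bsub>A \<union> B\<^esub>\<close>, where the sign \<open>\<epsilon>(A,B)\<close>
  counts the transpositions needed to sort the factors.\<close>

definition ext_sign :: "nat set \<Rightarrow> nat set \<Rightarrow> rat" where
  "ext_sign A B = (- 1) ^ card {(a, b). a \<in> A \<and> b \<in> B \<and> b < a}"

definition ext_mult :: "ext \<Rightarrow> ext \<Rightarrow> ext" (infixl \<open>\<^bold>*\<close> 70) where
  "f \<^bold>* g = (\<lambda>C. \<Sum>A\<in>Pow C. ext_sign A (C - A) * f A * g (C - A))"

definition ext_one :: ext where
  "ext_one = (\<lambda>A. of_bool (A = {}))"

definition theta :: "nat \<Rightarrow> ext" where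
  "theta i = (\<lambda>A. of_bool (A = {i}))"

definition theta_set :: "nat set \<Rightarrow> ext" where
  "theta_set A = foldr (\<lambda>i f. theta i \<^bold>* f) (sorted_list_of_set A) ext_one"

definition ext_ring :: "nat \<Rightarrow> ext ring" where
  "ext_ring n = \<lparr>carrier = {f. \<forall>A. f A \<noteq> 0 \<longrightarrow> A \<subseteq> {1..n}},
          mult = (\<^bold>*), one = ext_one, zero = 0, add = (+)\<rparr>"


subsection \<open>The model satisfies the defining properties\<close>

lemma ext_sign_empty [simp]: "ext_sign {} B = 1" "ext_sign A {} = 1"
  by (simp_all add: ext_sign_def)

lemma ext_one_left: "finite C \<Longrightarrow> (ext_one \<^bold>* f) C = f C"
  unfolding ext_mult_def ext_one_def
  by (subst sum.mono_neutral_right[of _ "{{}}"]) auto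

lemma ext_one_right: "finite C \<Longrightarrow> (f \<^bold>* ext_one) C = f C"
  unfolding ext_mult_def ext_one_def
  by (subst sum.mono_neutral_right[of _ "{C}"]) auto

lemma finite_inversions:
  "finite A \<Longrightarrow> finite B \<Longrightarrow> finite {(a, b). a \<in> A \<and> b \<in> B \<and> b < (a::nat)}"
  by (rule finite_subset[of _ "A \<times> B"]) auto

lemma ext_sign_Un_left:
  assumes "finite A" "finite B" "finite C" "A \<inter> B = {}"
  shows "ext_sign (A \<union> B) C = ext_sign A C * ext_sign B C"
proof -
  have "{(a, b). a \<in> A \<union> B \<and> b \<in> C \<and> b < a} =
        {(a, b). a \<in> A \<and> b \<in> C \<and> b < a} \<union> {(a, b). a \<in> B \<and> b \<in> C \<and> b < a}"
    by auto
  moreover have "{(a, b). a \<in> A \<and> b \<in> C \<and> b < a} \<inter> {(a, b). a \<in> B \<and> b \<in> C \<and> b < a} = {}"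
    using assms(4) by auto
  ultimately show ?thesis
    using assms by (simp add: ext_sign_def card_Un_disjoint finite_inversions power_add)
qed

lemma ext_sign_Un_right:
  assumes "finite A" "finite B" "finite C" "B \<inter> C = {}"
  shows "ext_sign A (B \<union> C) = ext_sign A B * ext_sign A C"
proof -
  have "{(a, b). a \<in> A \<and> b \<in> B \<union> C \<and> b < a} =
        {(a, b). a \<in> A \<and> b \<in> B \<and> b < a} \<union> {(a, b). a \<in> A \<and> b \<in> C \<and> b < a}"
    by auto
  moreover have "{(a, b). a \<in> A \<and> b \<in> B \<and> b < a} \<inter> {(a, b). a \<in> A \<and> b \<in> C \<and> b < a} = {}"
    using assms(4) by auto
  ultimately show ?thesis
    using assms by (simp add: ext_sign_def card_Un_disjoint finite_inversions power_add)
qed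

lemma ext_mult_assoc: "(f \<^bold>* g) \<^bold>* h = f \<^bold>* (g \<^bold>* h)"
proof
  fix C :: "nat set"
  show "((f \<^bold>* g) \<^bold>* h) C = (f \<^bold>* (g \<^bold>* h)) C"
  proof (cases "finite C")
    case False
    then show ?thesis by (simp add: ext_mult_def)
  next
    case True
    have fin: "finite A" if "A \<subseteq> C" for A
      using True that by (rule rev_finite_subset)
    have "((f \<^bold>* g) \<^bold>* h) C = (\<Sum>D\<in>Pow C. \<Sum>A\<in>Pow D.
        ext_sign D (C - D) * (ext_sign A (D - A) * f A * g (D - A)) * h (C - D))"
      by (simp add: ext_mult_def sum_distrib_left sum_distrib_right)
    also have "\<dots> = (\<Sum>(D, A)\<in>Sigma (Pow C) Pow.
        ext_sign D (C - D) * (ext_sign A (D - A) * f A * g (D - A)) * h (C - D))"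
      using True fin by (subst sum.Sigma) auto
    also have "\<dots> = (\<Sum>(A, B)\<in>Sigma (Pow C) (\<lambda>A. Pow (C - A)).
        ext_sign A (C - A) * f A * (ext_sign B (C - A - B) * g B * h (C - A - B)))"
    proof (rule sum.reindex_bij_witness[where i = "\<lambda>(A, B). (A \<union> B, A)" and
          j = "\<lambda>(D, A). (A, D - A)"], goal_cases)
      case (5 p)
      then obtain D A where p: "p = (D, A)" and sub: "A \<subseteq> D" "D \<subseteq> C" by auto
      define B E where "B = D - A" and "E = C - D"
      have fins: "finite A" "finite B" "finite E"
        using fin sub by (auto simp: B_def E_def)
      have eqs: "D = A \<union> B" "C - A = B \<union> E" "C - A - B = E" "D - A = B" "C - D = E"
        using sub by (auto simp: B_def E_def)
      have "ext_sign D E * ext_sign A B = ext_sign A (C - A) * ext_sign B E"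
        unfolding eqs(1,2)
        using sub fins by (subst ext_sign_Un_left, (auto simp: B_def)[4])
          (subst ext_sign_Un_right, auto simp: B_def E_def)
      then show ?case
        by (simp add: p eqs(3-5) mult_ac)
    qed auto
    also have "\<dots> = (\<Sum>A\<in>Pow C. \<Sum>B\<in>Pow (C - A).
        ext_sign A (C - A) * f A * (ext_sign B (C - A - B) * g B * h (C - A - B)))"
      using True fin by (subst sum.Sigma) auto
    also have "\<dots> = (f \<^bold>* (g \<^bold>* h)) C"
      by (simp add: ext_mult_def sum_distrib_left)
    finally show ?thesis .
  qed
qed

lemma ring_ext_ring: "ring (ext_ring n)"
proof (rule ringI)
  show "abelian_group (ext_ring n)"
  proof (rule abelian_groupI)
    fix f assume "f \<in> carrier (ext_ring n)"
    then show "\<exists>g\<in>carrier (ext_ring n). g \<oplus>\<^bsub>ext_ring n\<^esub> f = \<zero>\<^bsub>ext_ring n\<^esub>"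
      by (intro bexI[of _ "- f"]) (auto simp: ext_ring_def)
  next
    fix f g assume "f \<in> carrier (ext_ring n)" "g \<in> carrier (ext_ring n)"
    then show "f \<oplus>\<^bsub>ext_ring n\<^esub> g \<in> carrier (ext_ring n)"
      by (simp add: ext_ring_def) (metis add_0)
  qed (simp_all add: ext_ring_def add_ac)
next
  have one: "ext_one \<^bold>* f = f" "f \<^bold>* ext_one = f" if "f \<in> carrier (ext_ring n)" for f
  proof -
    have "(ext_one \<^bold>* f) A = f A \<and> (f \<^bold>* ext_one) A = f A" for A
    proof (cases "finite A")
      case True
      then show ?thesis by (simp add: ext_one_left ext_one_right)
    next
      case False
      with that have "f A = 0"
        using finite_subset[of A "{1..n}"] by (auto simp: ext_ring_def)
      with False show ?thesis by (simp add: ext_mult_def)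
    qed
    then show "ext_one \<^bold>* f = f" "f \<^bold>* ext_one = f" by auto
  qed
  have closed: "f \<^bold>* g \<in> carrier (ext_ring n)" if "f \<in> carrier (ext_ring n)" "g \<in> carrier (ext_ring n)" for f g
  proof -
    have "C \<subseteq> {1..n}" if "(f \<^bold>* g) C \<noteq> 0" for C
    proof -
      from that obtain A where A: "A \<in> Pow C"
        "ext_sign A (C - A) * f A * g (C - A) \<noteq> 0"
        unfolding ext_mult_def by (rule sum.not_neutral_contains_not_neutral)
      then have "A \<subseteq> {1..n}" "C - A \<subseteq> {1..n}"
        using \<open>f \<in> _\<close> \<open>g \<in> _\<close> by (simp_all add: ext_ring_def)
      then show ?thesis by blast
    qed
    then show ?thesis by (simp add: ext_ring_def)
  qed
  have "ext_one \<in> carrier (ext_ring n)"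
    by (simp add: ext_ring_def ext_one_def)
  moreover have "mult (ext_ring n) = (\<^bold>*)" "one (ext_ring n) = ext_one"
    by (simp_all add: ext_ring_def)
  ultimately show "monoid (ext_ring n)"
    by (intro monoidI) (simp_all only: one closed ext_mult_assoc)
next
  fix f g h
  show "(f \<oplus>\<^bsub>ext_ring n\<^esub> g) \<otimes>\<^bsub>ext_ring n\<^esub> h = f \<otimes>\<^bsub>ext_ring n\<^esub> h \<oplus>\<^bsub>ext_ring n\<^esub> g \<otimes>\<^bsub>ext_ring n\<^esub> h"
    by (rule ext) (simp add: ext_ring_def ext_mult_def distrib_left distrib_right sum.distrib)
  show "h \<otimes>\<^bsub>ext_ring n\<^esub> (f \<oplus>\<^bsub>ext_ring n\<^esub> g) = h \<otimes>\<^bsub>ext_ring n\<^esub> f \<oplus>\<^bsub>ext_ring n\<^esub> h \<otimes>\<^bsub>ext_ring n\<^esub> g"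
    by (rule ext) (simp add: ext_ring_def ext_mult_def distrib_left distrib_right sum.distrib)
qed

lemma theta_mult:
  assumes "finite A" "i \<notin> A" "\<And>a. a \<in> A \<Longrightarrow> i < a"
  shows "theta i \<^bold>* (\<lambda>B. of_bool (B = A)) = (\<lambda>B. of_bool (B = insert i A))"
proof
  fix C
  have sgn: "ext_sign {i} A = 1"
  proof -
    have "{(a, b). a \<in> {i} \<and> b \<in> A \<and> b < a} = {}" using assms(3) by fastforce
    then show ?thesis by (simp only: ext_sign_def card.empty power_0)
  qed
  show "(theta i \<^bold>* (\<lambda>B. of_bool (B = A))) C = of_bool (C = insert i A)"
  proof (cases "C = insert i A")
    case True
    then have "C - {i} = A" using assms(2) by auto
    then show ?thesis
      unfolding ext_mult_def theta_def using assms(1) sgn True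
      by (subst sum.mono_neutral_right[of _ "{{i}}"]) auto
  next
    case False
    have "ext_sign B (C - B) * theta i B * of_bool (C - B = A) = 0" if "B \<in> Pow C" for B
      using that False by (auto simp: theta_def)
    then show ?thesis using False by (simp add: ext_mult_def sum.neutral)
  qed
qed

text \<open>\<open>\<theta>\<^sub>A\<close> is the element all of whose coefficients vanish, except that at \<open>A\<close>, which is 1.\<close>

lemma theta_set_eq:
  assumes "finite A"
  shows "theta_set A = (\<lambda>B. of_bool (B = A))"
proof -
  have "foldr (\<lambda>i f. theta i \<^bold>* f) xs ext_one = (\<lambda>B. of_bool (B = set xs))"
    if "sorted_wrt (<) xs" for xs
    using that
  proof (induction xs)
    case Nil
    then show ?case by (simp add: ext_one_def)
  next
    case (Cons x xs)
    then show ?case by (simp, subst theta_mult) auto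
  qed
  from this[of "sorted_list_of_set A"] assms show ?thesis
    by (simp add: theta_set_def)
qed

lemma theta_square: "theta i \<^bold>* theta i = 0"
proof
  fix C
  have "ext_sign B (C - B) * theta i B * theta i (C - B) = 0" if "B \<in> Pow C" for B
    by (auto simp: theta_def)
  then show "(theta i \<^bold>* theta i) C = 0 C" by (simp add: ext_mult_def sum.neutral)
qed

lemma theta_anticommute:
  assumes "i \<noteq> j"
  shows "theta i \<^bold>* theta j = - (theta j \<^bold>* theta i)"
proof -
  have eq: "theta k \<^bold>* theta l = ext_sign {k} {l} *\<^sub>Q (\<lambda>B. of_bool (B = {k, l}))" if "k \<noteq> l" for k l
  proof
    fix C
    show "(theta k \<^bold>* theta l) C = (ext_sign {k} {l} *\<^sub>Q (\<lambda>B. of_bool (B = {k, l}))) C"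
    proof (cases "C = {k, l}")
      case True
      then have "C - {k} = {l}" using that by auto
      then show ?thesis
        unfolding ext_mult_def theta_def ext_scale_def using True
        by (subst sum.mono_neutral_right[of _ "{{k}}"]) auto
    next
      case False
      have "ext_sign B (C - B) * theta k B * theta l (C - B) = 0" if "B \<in> Pow C" for B
        using that False by (auto simp: theta_def)
      then show ?thesis using False by (simp add: ext_mult_def ext_scale_def sum.neutral)
    qed
  qed
  have sgn: "ext_sign {k} {l} = (if l < k then - 1 else 1)" for k l
  proof -
    have "{(a, b). a \<in> {k} \<and> b \<in> {l} \<and> b < a} = (if l < k then {(k, l)} else {})" by auto
    then show ?thesis by (simp add: ext_sign_def)
  qed
  show ?thesis
    using assms by (auto simp: eq sgn ext_scale_def fun_eq_iff insert_commute)
qed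


section \<open>Elementary symmetric elements and the ideal they generate\<close>

definition elem_F :: "nat \<Rightarrow> nat \<Rightarrow> ext" where
  "elem_F n r = (\<Sum>A | A \<subseteq> {1..n} \<and> card A = r. theta_set A)"

definition ideal_I :: "nat \<Rightarrow> ext set" where
  "ideal_I n = Idl\<^bsub>ext_ring n\<^esub> {elem_F n r | r. 1 \<le> r \<and> r \<le> n}"


lemma elem_F_carrier: "elem_F n r \<in> carrier (ext_ring n)"
proof -
  have fin: "finite A" if "A \<subseteq> {1..n}" for A
    using that finite_atLeastAtMost by (rule finite_subset)
  have "elem_F n r B = (\<Sum>A | A \<subseteq> {1..n} \<and> card A = r. of_bool (B = A))" for B
  proof -
    have "(\<Sum>A\<in>S. h A) B = (\<Sum>A\<in>S. h A B)" for S :: "nat set set" and h :: "nat set \<Rightarrow> ext"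
      by (induction S rule: infinite_finite_induct) auto
    then have "elem_F n r B = (\<Sum>A | A \<subseteq> {1..n} \<and> card A = r. theta_set A B)"
      by (simp add: elem_F_def)
    also have "\<dots> = (\<Sum>A | A \<subseteq> {1..n} \<and> card A = r. of_bool (B = A))"
      by (rule sum.cong) (simp_all add: theta_set_eq fin)
    finally show ?thesis .
  qed
  moreover have "(\<Sum>A | A \<subseteq> {1..n} \<and> card A = r. of_bool (B = A)) = (0::rat)" if "\<not> B \<subseteq> {1..n}" for B
    using that by (intro sum.neutral) auto
  ultimately show ?thesis unfolding ext_ring_def by auto
qed

lemma ideal_ideal_I: "ideal (ideal_I n) (ext_ring n)"
  unfolding ideal_I_def
  by (rule ring.genideal_ideal[OF ring_ext_ring]) (auto intro: elem_F_carrier)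


section \<open>Ballot sequences\<close>

text \<open>Strings over \<open>{0,1}\<close> are lists of Booleans, with \<open>True\<close> for 1.  List positions start at 0,
  so the sum of the first \<open>r\<close> entries is the sum of \<open>\<alpha> ! i\<close> over \<open>i < r\<close>.\<close>

definition breaks_ballot :: "bool list \<Rightarrow> bool" where
  "breaks_ballot \<alpha> \<longleftrightarrow>
     (\<exists>r\<in>{1..length \<alpha>}. (\<Sum>i<r. of_bool (\<alpha> ! i)) > (rat_of_nat r / 2))"

abbreviation m1 :: "bool list \<Rightarrow> nat" where
  "m1 u \<equiv> count_list u True"


section \<open>The elements \<open>G\<^sub>\<alpha>\<close>\<close>

lemma replicate_block_eq:
  assumes "replicate s True @ replicate t False = replicate s' True @ replicate t' False"
  shows "s = s' \<and> t = t'"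
proof -
  have "takeWhile id (replicate a True @ replicate b False) = replicate a True" for a b
    by (induction a) (auto simp: takeWhile_replicate)
  then have "s = s'" using assms by (metis length_replicate)
  with assms show ?thesis by (metis length_append length_replicate add_left_cancel)
qed

lemma block_neq:
  assumes "s \<ge> 1"
  shows "replicate s' True @ replicate t' False \<noteq> u @ [False] @ replicate s True @ replicate t False"
proof
  assume eq: "replicate s' True @ replicate t' False = u @ [False] @ replicate s True @ replicate t False"
  have "sorted (map Not (replicate s' True @ replicate t' False))"
    by (auto simp: sorted_append)
  with eq assms show False
    by (auto simp: sorted_append)
qed

lemma last_block_eq:
  assumes "u @ [False] @ replicate s True @ replicate t False =
           u' @ [False] @ replicate s' True @ replicate t' False"
    and "s \<ge> 1" "s' \<ge> 1"
  shows "u = u' \<and> s = s' \<and> t = t'"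
proof -
  let ?w = "\<lambda>u s t. u @ [False] @ replicate s True @ replicate t False"
  have rev: "rev (?w u s t) = replicate t False @ replicate s True @ False # rev u" for u s t
    by simp
  have tw: "takeWhile Not (rev (?w u s t)) = replicate t False"
    and dw: "dropWhile Not (rev (?w u s t)) = replicate s True @ False # rev u"
    if "s \<ge> 1" for u s t
  proof -
    from that obtain r where r: "s = Suc r" by (cases s) auto
    show "takeWhile Not (rev (?w u s t)) = replicate t False"
      "dropWhile Not (rev (?w u s t)) = replicate s True @ False # rev u"
      unfolding rev r by (induction t) simp_all
  qed
  have t: "t = t'"
    using tw[OF assms(2), of u t] tw[OF assms(3), of u' t'] assms(1) by (metis length_replicate)
  have dd: "replicate s True @ False # rev u = replicate s' True @ False # rev u'"
    using dw[OF assms(2), of u t] dw[OF assms(3), of u' t'] assms(1) by metis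
  have "takeWhile id (replicate a True @ False # xs) = replicate a True" for a xs
    by (induction a) auto
  then have s: "s = s'" using dd by (metis length_replicate)
  with dd t show ?thesis by simp
qed

lemma string_cases:
  fixes x :: "bool list"
  obtains (ones) s t where "x = replicate s True @ replicate t False"
  | (last) s u t where "s \<ge> 1" "x = u @ [False] @ replicate s True @ replicate t False"
proof -
  have "(\<exists>s t. x = replicate s True @ replicate t False) \<or>
        (\<exists>s u t. s \<ge> 1 \<and> x = u @ [False] @ replicate s True @ replicate t False)"
  proof (induction x)
    case Nil
    then show ?case by (intro disjI1 exI[of _ 0]) simp
  next
    case (Cons a x)
    then show ?case
    proof (elim disjE exE conjE)
      fix s t assume x: "x = replicate s True @ replicate t False"
      show ?thesis
      proof (cases a)
        case True
        then show ?thesis using x by (intro disjI1 exI[of _ "Suc s"] exI[of _ t]) simp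
      next
        case False
        show ?thesis
        proof (cases "s = 0")
          case True
          then show ?thesis using x False
            by (intro disjI1 exI[of _ 0] exI[of _ "Suc t"]) simp
        next
          case s: False
          then show ?thesis using x False
            by (intro disjI2 exI[of _ s] exI[of _ "[]"] exI[of _ t]) simp
        qed
      qed
    next
      fix s u t
      assume "1 \<le> s" "x = u @ [False] @ replicate s True @ replicate t False"
      then show ?thesis
        by (intro disjI2 exI[of _ s] exI[of _ "a # u"] exI[of _ t]) simp
    qed
  qed
  then show ?thesis using that by blast
qed

fun pos_sum :: "nat \<Rightarrow> bool list \<Rightarrow> nat" where
  "pos_sum k [] = 0"
| "pos_sum k (b # xs) = (if b then k else 0) + pos_sum (Suc k) xs"

lemma pos_sum_append: "pos_sum k (xs @ ys) = pos_sum k xs + pos_sum (k + length xs) ys"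
  by (induction xs arbitrary: k) auto

lemma pos_sum_zeros [simp]: "pos_sum k (replicate t False) = 0"
  by (induction t arbitrary: k) auto

lemma pos_sum_ones_mono: "pos_sum k (replicate s True) \<le> pos_sum (Suc k) (replicate s True)"
  by (induction s arbitrary: k) (auto intro: le_SucI add_le_mono)

lemma pos_sum_ones_Suc: "s \<ge> 1 \<Longrightarrow> pos_sum k (replicate s True) < pos_sum (Suc k) (replicate s True)"
  by (cases s) (auto simp: less_Suc_eq_le pos_sum_ones_mono)

lemma pos_sum_ones_pred:
  "s \<ge> 1 \<Longrightarrow> pos_sum k (replicate (s - 1) True) < pos_sum (Suc k) (replicate s True)"
proof -
  assume "s \<ge> 1"
  then obtain r where r: "s = Suc r" by (cases s) auto
  have "pos_sum k (replicate r True) \<le> pos_sum k (replicate r True @ [True])"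
    by (simp only: pos_sum_append le_add1)
  also have "replicate r True @ [True] = replicate s True"
    by (simp add: r replicate_append_same)
  also have "pos_sum k \<dots> < pos_sum (Suc k) \<dots>"
    using \<open>s \<ge> 1\<close> by (rule pos_sum_ones_Suc)
  finally show ?thesis by (simp add: r)
qed

text \<open>In the second equation \<open>k = length u + 1\<close> and \<open>t = n - k - s\<close>.\<close>

function elem_G :: "bool list \<Rightarrow> ext" where
  "elem_G (replicate s True @ replicate t False) = elem_F (s + t) s"
| "s \<ge> 1 \<Longrightarrow> elem_G (u @ [False] @ replicate s True @ replicate t False) =
     elem_G (u @ replicate s True @ replicate (t + 1) False)
     - (- 1) ^ m1 u *\<^sub>Q (theta (length u + 1) \<^bold>* elem_G (u @ replicate (s - 1) True @ replicate (t + 2) False))"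
  subgoal for P x by (cases x rule: string_cases) blast+
  subgoal by (metis replicate_block_eq)
  subgoal by (metis block_neq)
  subgoal by (metis last_block_eq)
  done

termination
  by (relation "measure (pos_sum 0)")
     (simp_all add: pos_sum_append pos_sum_ones_Suc pos_sum_ones_pred[simplified] del: replicate_Suc)

definition basis_A :: "nat \<Rightarrow> ext set" where
  "basis_A n = {elem_G \<alpha> | \<alpha>. length \<alpha> = n \<and> breaks_ballot \<alpha>}"

end

theory Submission
  imports Defs
begin

text \<open>
  The recursion for \<open>G\<^sub>\<alpha>\<close> only involves ballot-breaking strings when \<open>\<alpha>\<close> breaks the ballot condition,
  so these \<open>G\<^sub>\<alpha>\<close> lie in the ideal.  In the lexicographic order on sets, where an earlier element
  counts more, the leading monomial of \<open>G\<^sub>\<alpha>\<close> is \<open>\<theta>\<^sub>\<alpha>\<close> with coefficient 1; hence they are independent,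
  and modulo their span every element of the ideal has no coefficient at a ballot-breaking set.
  It remains to see that such an element \<open>f\<close> vanishes.  Otherwise its leading set \<open>S\<close> is ballot, so
  the elements of \<open>S\<close>, read as closing parentheses, are matched without crossings to earlier
  positions outside \<open>S\<close>.  Pairing with the product of the differences \<open>\<theta>\<^bsub>m b\<^esub> - \<theta>\<^sub>b\<close> over the matched
  pairs \<open>(m b, b)\<close> kills the ideal, by a sign-reversing involution that uses the absence of
  crossings; but all monomials of this product other than \<open>\<theta>\<^sub>S\<close> are lexicographically greater
  than \<open>\<theta>\<^sub>S\<close>, so its pairing with \<open>f\<close> is a nonzero multiple of \<open>f S\<close>.
\<close>

section \<open>Products in the exterior algebra\<close>

lemma ext_sum_apply: "(\<Sum>i\<in>S. h i) A = (\<Sum>i\<in>S. (h i :: ext) A)"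
  by (induction S rule: infinite_finite_induct) auto

lemma elem_F_apply: "elem_F n r A = of_bool (A \<subseteq> {1..n} \<and> card A = r)"
proof -
  have fin: "finite {B. B \<subseteq> {1..n} \<and> card B = r}"
    by (rule finite_subset[of _ "Pow {1..n}"]) auto
  have "elem_F n r A = (\<Sum>B | B \<subseteq> {1..n} \<and> card B = r. of_bool (A = B))"
    unfolding elem_F_def ext_sum_apply
    by (intro sum.cong refl) (auto simp: theta_set_eq finite_subset)
  also have "\<dots> = (\<Sum>B | B \<subseteq> {1..n} \<and> card B = r. if B = A then 1 else 0)"
    by (intro sum.cong refl) auto
  also have "\<dots> = of_bool (A \<subseteq> {1..n} \<and> card A = r)"
    by (simp only: sum.delta fin) simp
  finally show ?thesis .
qed

lemma ext_sign_singleton_left: "ext_sign {k} B = (- 1) ^ card {b \<in> B. b < k}"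
proof -
  have "{(a, b). a \<in> {k} \<and> b \<in> B \<and> b < a} = Pair k ` {b \<in> B. b < k}" by auto
  then show ?thesis by (simp add: ext_sign_def card_image inj_on_def)
qed

lemma ext_sign_singleton_right: "ext_sign B {k} = (- 1) ^ card {b \<in> B. k < b}"
proof -
  have "{(a, b). a \<in> B \<and> b \<in> {k} \<and> b < a} = (\<lambda>a. (a, k)) ` {b \<in> B. k < b}" by auto
  then show ?thesis by (simp add: ext_sign_def card_image inj_on_def)
qed

lemma theta_mult_apply:
  assumes "finite A"
  shows "(theta k \<^bold>* g) A = (if k \<in> A then (- 1) ^ card {x \<in> A. x < k} * g (A - {k}) else 0)"
proof (cases "k \<in> A")
  case True
  have "{x \<in> A - {k}. x < k} = {x \<in> A. x < k}" by auto
  then show ?thesis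
    unfolding ext_mult_def theta_def using assms True
    by (subst sum.mono_neutral_right[of _ "{{k}}"]) (auto simp: ext_sign_singleton_left)
next
  case False
  then have "ext_sign B (A - B) * theta k B * g (A - B) = 0" if "B \<in> Pow A" for B
    using that by (auto simp: theta_def)
  then show ?thesis using False by (simp add: ext_mult_def sum.neutral)
qed

text \<open>Every pair in the product of the two sets is an inversion for exactly one of the two
  orders, so the inversion numbers add up to \<open>card A * card B\<close>.\<close>

lemma ext_sign_swap:
  assumes "finite A" "finite B" "A \<inter> B = {}"
  shows "ext_sign A B * ext_sign B A = (- 1) ^ (card A * card B)"
proof -
  let ?P = "{(a, b). a \<in> A \<and> b \<in> B \<and> b < a}" and ?Q = "{(b, a). b \<in> B \<and> a \<in> A \<and> a < b}"
  have "A \<times> B = ?P \<union> prod.swap ` ?Q"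
  proof (intro equalityI subsetI)
    fix p assume "p \<in> A \<times> B"
    then obtain a b where p: "p = (a, b)" "a \<in> A" "b \<in> B" by auto
    with assms(3) have "b < a \<or> a < b" by (metis disjoint_iff linorder_less_linear)
    with p show "p \<in> ?P \<union> prod.swap ` ?Q" by force
  qed auto
  moreover have "?P \<inter> prod.swap ` ?Q = {}" by auto
  moreover have "finite ?P" "finite ?Q" using assms finite_inversions by auto
  ultimately have "card A * card B = card ?P + card (prod.swap ` ?Q)"
    by (subst card_cartesian_product[symmetric], simp only:)
      (intro card_Un_disjoint finite_imageI)
  also have "card (prod.swap ` ?Q) = card ?Q" by (intro card_image) (auto simp: inj_on_def)
  finally show ?thesis by (simp add: ext_sign_def power_add)
qed

text \<open>\<open>elem_F n r\<close> is homogeneous of degree \<open>r\<close>, so passing it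
  across the degree \<open>d\<close> part of \<open>h\<close> costs the sign with exponent
  \<open>r * d\<close>. This turns every two-sided multiple of a generator into a left
  multiple.\<close>

lemma elem_F_mult_commute:
  "elem_F n r \<^bold>* h = (\<lambda>A. (- 1) ^ (r * card A) * h A) \<^bold>* elem_F n r"
proof
  fix C
  show "(elem_F n r \<^bold>* h) C = ((\<lambda>A. (- 1) ^ (r * card A) * h A) \<^bold>* elem_F n r) C"
  proof (cases "finite C")
    case True
    show ?thesis unfolding ext_mult_def
    proof (rule sum.reindex_bij_witness[where i = "\<lambda>A. C - A" and j = "\<lambda>A. C - A"], goal_cases)
      case (5 A)
      have fin: "finite A" "finite (C - A)" using True 5 finite_subset by auto
      have CC: "C - (C - A) = A" using 5 by auto
      have sw: "ext_sign A (C - A) * ext_sign (C - A) A = (- 1) ^ (card A * card (C - A))"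
        using ext_sign_swap[OF fin] by auto
      moreover have "ext_sign (C - A) A * ext_sign (C - A) A = 1"
        by (simp add: ext_sign_def flip: power_add mult_2)
      ultimately have "ext_sign A (C - A) = (- 1) ^ (card A * card (C - A)) * ext_sign (C - A) A"
        by (metis mult.assoc mult.right_neutral)
      then show ?case by (auto simp: CC elem_F_apply)
    qed auto
  qed (simp add: ext_mult_def)
qed

section \<open>Closure properties of the ideal\<close>

lemma ideal_I_add: "f \<in> ideal_I n \<Longrightarrow> g \<in> ideal_I n \<Longrightarrow> f + g \<in> ideal_I n"
  using additive_subgroup.a_closed[OF ideal.axioms(1)[OF ideal_ideal_I[of n]]]
  by (simp add: ext_ring_def)

lemma ideal_I_zero: "0 \<in> ideal_I n"
  using additive_subgroup.zero_closed[OF ideal.axioms(1)[OF ideal_ideal_I[of n]]]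
  by (simp add: ext_ring_def)

lemma ideal_I_carrier: "f \<in> ideal_I n \<Longrightarrow> f \<in> carrier (ext_ring n)"
  using additive_subgroup.a_Hcarr[OF ideal.axioms(1)[OF ideal_ideal_I[of n]]] by blast

lemma ideal_I_mult_left:
  "f \<in> ideal_I n \<Longrightarrow> g \<in> carrier (ext_ring n) \<Longrightarrow> g \<^bold>* f \<in> ideal_I n"
  using ideal.I_l_closed[OF ideal_ideal_I[of n]] by (simp add: ext_ring_def)

lemma ideal_I_scale:
  assumes "f \<in> ideal_I n"
  shows "c *\<^sub>Q f \<in> ideal_I n"
proof -
  have "((c *\<^sub>Q ext_one) \<^bold>* f) A = (c *\<^sub>Q f) A" for A
  proof (cases "finite A")
    case True
    then show ?thesis
      using ext_one_left[of A f]
      by (simp add: ext_mult_def ext_scale_def mult_ac flip: sum_distrib_left)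
  next
    case False
    \<comment> \<open>At an infinite set the product is a sum over an infinite index set, hence 0 by
      convention, and \<open>f\<close> is supported on subsets of \<open>{1..n}\<close>.\<close>
    then have "f A = 0"
      using ideal_I_carrier[OF assms] finite_subset[of A "{1..n}"] by (auto simp: ext_ring_def)
    with False show ?thesis by (simp add: ext_mult_def ext_scale_def)
  qed
  then have "(c *\<^sub>Q ext_one) \<^bold>* f = c *\<^sub>Q f" by auto
  moreover have "c *\<^sub>Q ext_one \<in> carrier (ext_ring n)"
    by (auto simp: ext_ring_def ext_scale_def ext_one_def)
  ultimately show ?thesis using ideal_I_mult_left[OF assms] by metis
qed

lemma subspace_ideal_I: "ext.subspace (ideal_I n)"
  by (intro ext.subspaceI ideal_I_zero ideal_I_add ideal_I_scale)

lemma theta_carrier: "1 \<le> k \<Longrightarrow> k \<le> n \<Longrightarrow> theta k \<in> carrier (ext_ring n)"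
  by (auto simp: ext_ring_def theta_def)


section \<open>Ballot-breaking strings give elements of the ideal\<close>

lemma sum_of_bool_nth_eq_m1:
  "r \<le> length \<alpha> \<Longrightarrow> (\<Sum>i<r. of_bool (\<alpha> ! i)) = rat_of_nat (m1 (take r \<alpha>))"
  by (induction r) (simp_all add: take_Suc_conv_app_nth)

lemma breaks_ballot_iff: "breaks_ballot \<alpha> \<longleftrightarrow> (\<exists>r\<le>length \<alpha>. r < 2 * m1 (take r \<alpha>))"
proof -
  have *: "rat_of_nat m > rat_of_nat r / 2 \<longleftrightarrow> r < 2 * m" for m r
  proof -
    have "rat_of_nat m > rat_of_nat r / 2 \<longleftrightarrow> rat_of_nat r < rat_of_nat (2 * m)"
      by (simp add: field_simps)
    then show ?thesis by (simp only: of_nat_less_iff)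
  qed
  have "breaks_ballot \<alpha> \<longleftrightarrow> (\<exists>r\<in>{1..length \<alpha>}. r < 2 * m1 (take r \<alpha>))"
    unfolding breaks_ballot_def by (intro bex_cong refl) (simp only: atLeastAtMost_iff sum_of_bool_nth_eq_m1 *)
  also have "\<dots> \<longleftrightarrow> (\<exists>r\<le>length \<alpha>. r < 2 * m1 (take r \<alpha>))"
  proof
    assume "\<exists>r\<le>length \<alpha>. r < 2 * m1 (take r \<alpha>)"
    then obtain r where r: "r \<le> length \<alpha>" "r < 2 * m1 (take r \<alpha>)" by blast
    then have "r \<noteq> 0" by (intro notI) simp
    with r show "\<exists>r\<in>{1..length \<alpha>}. r < 2 * m1 (take r \<alpha>)" by (intro bexI[of _ r]) auto
  qed auto
  finally show ?thesis .
qed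

lemma breaks_ballot_Nil [simp]: "\<not> breaks_ballot []"
  by (simp add: breaks_ballot_iff)

lemma breaks_ballot_snoc:
  "breaks_ballot (\<alpha> @ [x]) \<longleftrightarrow> breaks_ballot \<alpha> \<or> length \<alpha> + 1 < 2 * m1 (\<alpha> @ [x])"
  by (auto simp: breaks_ballot_iff le_Suc_eq)

lemma not_breaks_ballotD: "\<not> breaks_ballot \<alpha> \<Longrightarrow> 2 * m1 \<alpha> \<le> length \<alpha>"
  by (metis breaks_ballot_iff leI order_refl take_all)

lemma breaks_ballot_append_zeros:
  "breaks_ballot (\<alpha> @ replicate t False) \<longleftrightarrow> breaks_ballot \<alpha>"
proof (induction t)
  case (Suc t)
  have "breaks_ballot (\<alpha> @ replicate (Suc t) False)
      \<longleftrightarrow> breaks_ballot ((\<alpha> @ replicate t False) @ [False])"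
    by (simp add: replicate_append_same)
  also have "\<dots> \<longleftrightarrow> breaks_ballot \<alpha>"
    using Suc not_breaks_ballotD[of "\<alpha> @ replicate t False"]
    unfolding breaks_ballot_snoc by auto
  finally show ?case .
qed simp

lemma count_list_replicate_same: "count_list (replicate s x) x = s"
  by (induction s) auto

text \<open>Each appended 1 raises twice the number of ones minus the length by one, so among the
  new prefixes only the last has to be tested.\<close>

lemma breaks_ballot_append_ones:
  "breaks_ballot (u @ replicate s True) \<longleftrightarrow> breaks_ballot u \<or> length u < 2 * m1 u + s"
proof (induction s)
  case 0
  then show ?case using not_breaks_ballotD[of u] leD by auto
next
  case (Suc s)
  have "breaks_ballot (u @ replicate (Suc s) True)
      \<longleftrightarrow> breaks_ballot ((u @ replicate s True) @ [True])"
    by (simp add: replicate_append_same)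
  also have "\<dots> \<longleftrightarrow> breaks_ballot u \<or> length u < 2 * m1 u + Suc s"
    using Suc not_breaks_ballotD[of u]
    unfolding breaks_ballot_snoc by (auto simp: count_list_replicate_same)
  finally show ?case .
qed

lemma breaks_ballot_block:
  "breaks_ballot (u @ replicate s True @ replicate t False)
    \<longleftrightarrow> breaks_ballot u \<or> length u < 2 * m1 u + s"
  using breaks_ballot_append_zeros[of "u @ replicate s True" t] breaks_ballot_append_ones[of u s]
  by simp

text \<open>By \<open>breaks_ballot_block\<close>, breaking is decided in \<open>u\<close> or at the
  end of the final run of ones. Moving that run one step left makes breaking easier, and moving it
  left while dropping one 1 leaves the criterion unchanged, so both strings of the recursion break
  again.\<close>

lemma elem_G_in_ideal_I: "breaks_ballot \<alpha> \<Longrightarrow> elem_G \<alpha> \<in> ideal_I (length \<alpha>)"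
proof (induction \<alpha> rule: elem_G.induct)
  case (1 s t)
  \<comment> \<open>Breaking excludes the zero string, so \<open>elem_F (s + t) s\<close> is one of
    the generators.\<close>
  then have "1 \<le> s" using breaks_ballot_block[of "[]" s t] by simp
  then have "elem_F (s + t) s \<in> ideal_I (s + t)"
    unfolding ideal_I_def
    by (intro subsetD[OF ring.genideal_self[OF ring_ext_ring]]) (auto intro: elem_F_carrier)
  then show ?case by simp
next
  case (2 s u t)
  let ?n = "length u + Suc (s + t)"
  from 2(4) have "breaks_ballot u \<or> length u + 1 < 2 * m1 u + s"
    using breaks_ballot_block[of "u @ [False]" s t] by (auto simp: breaks_ballot_snoc)
  then have br: "breaks_ballot (u @ replicate s True @ replicate (t + 1) False)"
      "breaks_ballot (u @ replicate (s - 1) True @ replicate (t + 2) False)"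
    unfolding breaks_ballot_block by auto
  have len: "length (u @ replicate s True @ replicate (t + 1) False) = ?n"
      "length (u @ replicate (s - 1) True @ replicate (t + 2) False) = ?n"
      "length (u @ [False] @ replicate s True @ replicate t False) = ?n"
    using 2(1) by auto
  have "theta (length u + 1) \<^bold>* elem_G (u @ replicate (s - 1) True @ replicate (t + 2) False) \<in> ideal_I ?n"
    using 2(3)[OF br(2)] unfolding len by (intro ideal_I_mult_left theta_carrier) auto
  then show ?case
    using 2(2)[OF br(1)] subspace_ideal_I[of ?n] unfolding len elem_G.simps(2)[OF 2(1)]
    by (intro ext.subspace_diff ext.subspace_scale)
qed


section \<open>Leading monomials\<close>

text \<open>Positions count from 1 and list indices from 0, hence the shift.\<close>

definition ones :: "bool list \<Rightarrow> nat set" where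
  "ones \<alpha> = {i \<in> {1..length \<alpha>}. \<alpha> ! (i - 1)}"

text \<open>The lexicographic order of the characteristic strings, with 1 above 0.\<close>

definition lex_greater :: "nat set \<Rightarrow> nat set \<Rightarrow> bool" where
  "lex_greater A B \<longleftrightarrow> (\<exists>x\<in>A - B. \<forall>y<x. y \<in> A \<longleftrightarrow> y \<in> B)"

lemma ones_Nil [simp]: "ones [] = {}"
  by (simp add: ones_def)

lemma ones_snoc: "ones (u @ [x]) = (if x then insert (length u + 1) (ones u) else ones u)"
  by (force simp: ones_def nth_append le_Suc_eq)

lemma ones_subset: "ones \<alpha> \<subseteq> {1..length \<alpha>}"
  by (auto simp: ones_def)

lemma finite_ones [simp]: "finite (ones \<alpha>)"
  by (rule finite_subset[OF ones_subset]) simp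

lemma card_ones: "card (ones \<alpha>) = m1 \<alpha>"
proof (induction \<alpha> rule: rev_induct)
  case (snoc x u)
  have "length u + 1 \<notin> ones u" using ones_subset[of u] by auto
  with snoc show ?case by (simp add: ones_snoc)
qed simp

lemma ones_surj:
  assumes "A \<subseteq> {1..n}"
  obtains \<alpha> where "length \<alpha> = n" "ones \<alpha> = A"
proof
  have "map (\<lambda>i. Suc i \<in> A) [0..<n] ! (x - 1) \<longleftrightarrow> x \<in> A" if "x \<in> {1..n}" for x
    using that by (subst nth_map) auto
  then show "ones (map (\<lambda>i. Suc i \<in> A) [0..<n]) = A"
    using assms unfolding ones_def by auto
qed simp

lemma ones_inj:
  assumes "length \<alpha> = length \<beta>" "ones \<alpha> = ones \<beta>"
  shows "\<alpha> = \<beta>"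
proof (rule nth_equalityI[OF assms(1)])
  fix i assume "i < length \<alpha>"
  then have "Suc i \<in> ones \<alpha> \<longleftrightarrow> \<alpha> ! i" "Suc i \<in> ones \<beta> \<longleftrightarrow> \<beta> ! i"
    using assms(1) by (auto simp: ones_def)
  with assms(2) show "\<alpha> ! i = \<beta> ! i" by simp
qed

section \<open>The lexicographic order on sets of positions\<close>

lemma lex_greater_irrefl: "\<not> lex_greater A A"
  by (simp add: lex_greater_def)

lemma lex_greater_trans:
  assumes "lex_greater A B" "lex_greater B C"
  shows "lex_greater A C"
proof -
  obtain x where x: "x \<in> A - B" "\<forall>y<x. y \<in> A \<longleftrightarrow> y \<in> B"
    using assms(1) by (auto simp: lex_greater_def)
  obtain z where z: "z \<in> B - C" "\<forall>y<z. y \<in> B \<longleftrightarrow> y \<in> C"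
    using assms(2) by (auto simp: lex_greater_def)
  \<comment> \<open>The earlier of the two first differences is the first difference between
    \<open>A\<close> and \<open>C\<close>.\<close>
  have "min x z \<in> A - C" using x z by (cases x z rule: linorder_cases) auto
  moreover have "\<forall>y<min x z. y \<in> A \<longleftrightarrow> y \<in> C" using x(2) z(2) by simp
  ultimately show ?thesis unfolding lex_greater_def by (rule bexI[rotated])
qed

text \<open>The least element of the symmetric difference decides.\<close>

lemma lex_greater_linear:
  assumes "A \<noteq> B"
  shows "lex_greater A B \<or> lex_greater B A"
proof -
  have "\<exists>x. x \<in> A \<longleftrightarrow> x \<notin> B" using assms by blast
  then obtain x where x: "x \<in> A \<longleftrightarrow> x \<notin> B" "\<And>y. y < x \<Longrightarrow> \<not> (y \<in> A \<longleftrightarrow> y \<notin> B)"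
    using exists_least_iff[of "\<lambda>x. x \<in> A \<longleftrightarrow> x \<notin> B"] by metis
  then have "\<forall>y<x. y \<in> A \<longleftrightarrow> y \<in> B" "\<forall>y<x. y \<in> B \<longleftrightarrow> y \<in> A" by simp_all
  then show ?thesis
    using x(1) unfolding lex_greater_def by (cases "x \<in> A") (auto intro!: bexI[of _ x])
qed

lemma lex_max_exists:
  assumes "finite X" "X \<noteq> {}"
  obtains A where "A \<in> X" "\<forall>B\<in>X. B \<noteq> A \<longrightarrow> lex_greater A B"
proof -
  have "\<exists>A\<in>X. \<forall>B\<in>X. B \<noteq> A \<longrightarrow> lex_greater A B"
    using assms
  proof (induction rule: finite_ne_induct)
    case (insert C X)
    then obtain A where A: "A \<in> X" "\<forall>B\<in>X. B \<noteq> A \<longrightarrow> lex_greater A B" by blast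
    have "A \<noteq> C" using A(1) insert.hyps by blast
    then consider "lex_greater A C" | "lex_greater C A" using lex_greater_linear by blast
    then show ?case
    proof cases
      case 2
      then have "\<forall>B\<in>X. lex_greater C B" using A(2) lex_greater_trans by metis
      then show ?thesis by blast
    qed (use A in blast)
  qed simp
  with that show ?thesis by blast
qed

text \<open>If \<open>A\<close> agrees with \<open>u\<close> before position \<open>k\<close> but contains \<open>k\<close>, the two terms of the recursion
  for \<open>u01\<^sup>s0\<^sup>t\<close> contribute equal coefficients and cancel.\<close>

lemma elem_G_block_apply:
  assumes "A \<subseteq> {1..length u + s + t}"
  shows "(A \<inter> {1..length u} = ones u \<longrightarrow>
            elem_G (u @ replicate s True @ replicate t False) A = of_bool (card A = m1 u + s)) \<and>
         (lex_greater (A \<inter> {1..length u}) (ones u) \<longrightarrow>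
            elem_G (u @ replicate s True @ replicate t False) A = 0)"
  using assms
\<comment> \<open>The recursion shortens \<open>u\<close> from the right while the final block
  changes, so \<open>s\<close>, \<open>t\<close> and \<open>A\<close> have to vary.\<close>
proof (induction u arbitrary: s t A rule: rev_induct)
  case Nil
  then show ?case by (simp add: elem_F_apply lex_greater_def)
next
  case (snoc x u)
  define k where "k = length u + 1"
  let ?B = "A \<inter> {1..length u}"
  have "finite A" using snoc.prems finite_subset by blast
  have k: "k \<notin> ones u" using ones_subset[of u] by (auto simp: k_def)
  have Ak: "A \<inter> {1..length (u @ [x])} = (if k \<in> A then insert k ?B else ?B)"
    by (auto simp: k_def le_Suc_eq Suc_le_eq)
  have eq_iff: "?B = ones u \<and> (k \<in> A \<longleftrightarrow> x)" if "A \<inter> {1..length (u @ [x])} = ones (u @ [x])"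
  proof -
    have "k \<notin> ?B" by (simp add: k_def)
    then show ?thesis
      using that k unfolding Ak ones_snoc k_def[symmetric] by (auto simp: insert_ident split: if_splits)
  qed
  have gr: "lex_greater ?B (ones u) \<or> ?B = ones u \<and> k \<in> A \<and> \<not> x"
    if gt: "lex_greater (A \<inter> {1..length (u @ [x])}) (ones (u @ [x]))"
  proof -
    have memA: "y \<in> A \<inter> {1..length (u @ [x])} \<longleftrightarrow> y \<in> ?B \<or> y = k \<and> k \<in> A" for y
      unfolding Ak by auto
    have memO: "y \<in> ones (u @ [x]) \<longleftrightarrow> y \<in> ones u \<or> y = k \<and> x" for y
      by (auto simp: ones_snoc k_def)
    have lt: "y < k" if "y \<in> ?B \<or> y \<in> ones u" for y
      using that ones_subset[of u] by (auto simp: k_def)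
    from gt obtain z where z: "z \<in> ?B \<or> z = k \<and> k \<in> A" "\<not> (z \<in> ones u \<or> z = k \<and> x)"
      "\<forall>y<z. (y \<in> ?B \<or> y = k \<and> k \<in> A) \<longleftrightarrow> (y \<in> ones u \<or> y = k \<and> x)"
      unfolding lex_greater_def Diff_iff memA memO bex_simps Bex_def by (elim exE conjE)
    have eq: "y \<in> ?B \<longleftrightarrow> y \<in> ones u" if "y < z" "y \<noteq> k" for y
      using z(3)[rule_format, OF that(1)] that(2) by blast
    show ?thesis
    proof (cases "z = k")
      case True
      have "y \<in> ?B \<longleftrightarrow> y \<in> ones u" for y
        using eq[of y] lt[of y] True by (metis less_irrefl)
      then have "?B = ones u" by blast
      then show ?thesis using z(1,2) True lt by blast
    next
      case False
      then have "z \<in> ?B - ones u" "z < k" using z(1,2) lt by auto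
      moreover have "\<forall>y<z. y \<in> ?B \<longleftrightarrow> y \<in> ones u"
        using eq \<open>z < k\<close> by (metis less_asym)
      ultimately show ?thesis unfolding lex_greater_def by blast
    qed
  qed
  define G where "G = elem_G ((u @ [x]) @ replicate s True @ replicate t False)"
  \<comment> \<open>These are the cases to which \<open>eq_iff\<close> and \<open>gr\<close> reduce
    the hypotheses on \<open>u @ [x]\<close>; in the third one \<open>A\<close> first differs at
    \<open>k\<close>.\<close>
  have "(?B = ones u \<longrightarrow> (k \<in> A \<longleftrightarrow> x) \<longrightarrow> G A = of_bool (card A = m1 (u @ [x]) + s)) \<and>
      (lex_greater ?B (ones u) \<longrightarrow> G A = 0) \<and> (?B = ones u \<longrightarrow> k \<in> A \<longrightarrow> \<not> x \<longrightarrow> G A = 0)"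
  proof -
    consider (one) x | (zero) "\<not> x" "s = 0" | (block) "\<not> x" "s \<ge> 1" by linarith
    then show ?thesis
    proof cases
      case one
      have "A \<subseteq> {1..length u + (s + 1) + t}" using snoc.prems by simp
      from snoc.IH[OF this] show ?thesis using one by (simp add: G_def)
    next
      case zero
      \<comment> \<open>With an empty block of ones, the final 0 of the prefix joins the trailing
        zeros.\<close>
      have "A \<subseteq> {1..length u + 0 + (t + 1)}" using snoc.prems zero by simp
      note IH = snoc.IH[OF this]
      \<comment> \<open>Such an \<open>A\<close> contains \<open>ones u\<close> and also
        \<open>k\<close>, so it is too large to have coefficient 1.\<close>
      have "card A \<noteq> m1 u" if "?B = ones u" "k \<in> A"
      proof -
        have "insert k (ones u) \<subseteq> A" using that by auto
        then have "card (insert k (ones u)) \<le> card A" using \<open>finite A\<close> by (rule card_mono[rotated])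
        then show ?thesis using k by (simp add: card_ones)
      qed
      then show ?thesis using IH zero by (simp add: G_def)
    next
      case block
      let ?G1 = "elem_G (u @ replicate s True @ replicate (t + 1) False)"
      let ?G2 = "elem_G (u @ replicate (s - 1) True @ replicate (t + 2) False)"
      have G: "G A = ?G1 A - (- 1) ^ m1 u * (theta k \<^bold>* ?G2) A"
        using block elem_G.simps(2)[of s u t] by (simp add: G_def k_def ext_scale_def)
      have "A \<subseteq> {1..length u + s + (t + 1)}" using snoc.prems by simp
      note IH1 = snoc.IH[OF this]
      have "A - {k} \<subseteq> {1..length u + (s - 1) + (t + 2)}" using snoc.prems block by auto
      moreover have "(A - {k}) \<inter> {1..length u} = ?B" by (auto simp: k_def)
      ultimately have IH2: "(?B = ones u \<longrightarrow> ?G2 (A - {k}) = of_bool (card (A - {k}) = m1 u + (s - 1))) \<and>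
          (lex_greater ?B (ones u) \<longrightarrow> ?G2 (A - {k}) = 0)"
        using snoc.IH[of "A - {k}" "s - 1" "t + 2"] by simp
      have "{y \<in> A. y < k} = ?B" using snoc.prems by (auto simp: k_def)
      then have th: "(theta k \<^bold>* ?G2) A = (if k \<in> A then (- 1) ^ card ?B * ?G2 (A - {k}) else 0)"
        using theta_mult_apply[OF \<open>finite A\<close>] by simp
      \<comment> \<open>The sign of moving \<open>theta k\<close> past the \<open>m1 u\<close>
        elements of \<open>A\<close> before \<open>k\<close> cancels the sign written in the
        recursion.\<close>
      have "G A = 0" if "?B = ones u" "k \<in> A"
      proof -
        have "card A = Suc (card (A - {k}))"
          using that(2) \<open>finite A\<close> by (metis card_Suc_Diff1)
        then have "card A = m1 u + s \<longleftrightarrow> card (A - {k}) = m1 u + (s - 1)" using block by linarith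
        then have "?G1 A = ?G2 (A - {k})" using IH1 IH2 that(1) by simp
        moreover have "(- 1) ^ m1 u * ((- 1) ^ m1 u * a) = a" for a :: rat
          by (simp flip: mult.assoc power_add mult_2)
        ultimately show ?thesis unfolding G th using that by (simp add: card_ones)
      qed
      moreover have "G A = 0" if "lex_greater ?B (ones u)"
        unfolding G th using that IH1 IH2 by simp
      moreover have "G A = of_bool (card A = m1 (u @ [x]) + s)" if "?B = ones u" "k \<notin> A"
        unfolding G th using that IH1 block by simp
      ultimately show ?thesis using block by blast
    qed
  qed
  then show ?case
    unfolding G_def[symmetric] using eq_iff gr by blast
qed

lemma elem_G_leading: "elem_G \<alpha> (ones \<alpha>) = 1"
proof -
  have "ones \<alpha> \<inter> {1..length \<alpha>} = ones \<alpha>" "ones \<alpha> \<subseteq> {1..length \<alpha> + 0 + 0}"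
    using ones_subset[of \<alpha>] by auto
  then show ?thesis
    using elem_G_block_apply[of "ones \<alpha>" \<alpha> 0 0] by (simp add: card_ones)
qed

lemma elem_G_lex_greater:
  assumes "A \<subseteq> {1..length \<alpha>}" "lex_greater A (ones \<alpha>)"
  shows "elem_G \<alpha> A = 0"
  using elem_G_block_apply[of A \<alpha> 0 0] assms by (simp add: Int_absorb2)

section \<open>Linear independence\<close>

text \<open>A linear relation is evaluated at the greatest leading set that occurs with a nonzero
  scalar, where only one term survives. Equal lengths make the leading sets of distinct vectors
  distinct.\<close>

lemma independent_elem_G:
  assumes "\<And>\<alpha>. \<alpha> \<in> X \<Longrightarrow> length \<alpha> = n"
  shows "ext.independent (elem_G ` X)"
  unfolding ext.independent_explicit_finite_subsets
proof (intro allI impI ballI, rule ccontr)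
  fix T c v0
  assume T: "T \<subseteq> elem_G ` X" "finite T" "(\<Sum>v\<in>T. c v *\<^sub>Q v) = 0" "v0 \<in> T" "c v0 \<noteq> 0"
  \<comment> \<open>A chosen preimage under \<open>elem_G\<close>, whose injectivity has not been
    established.\<close>
  define str where "str = inv_into X elem_G"
  have str: "str v \<in> X" "elem_G (str v) = v" if "v \<in> T" for v
    using T(1) that unfolding str_def by (blast intro: inv_into_into f_inv_into_f)+
  let ?Z = "(\<lambda>v. ones (str v)) ` {v \<in> T. c v \<noteq> 0}"
  have "finite ?Z" "?Z \<noteq> {}" using T(2,4,5) by auto
  then obtain A where A: "A \<in> ?Z" "\<forall>B\<in>?Z. B \<noteq> A \<longrightarrow> lex_greater A B"
    by (rule lex_max_exists)
  from A(1) obtain v where v: "v \<in> T" "c v \<noteq> 0" "A = ones (str v)" by auto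
  have "c w * w A = 0" if w: "w \<in> T - {v}" for w
  proof (cases "c w = 0")
    case False
    have "ones (str w) \<noteq> A"
    proof
      assume "ones (str w) = A"
      then have "str w = str v" using str v w assms by (intro ones_inj) auto
      then show False using str[of v] str[of w] v w by auto
    qed
    then have "lex_greater A (ones (str w))" using A(2) w False by auto
    then have "elem_G (str w) A = 0"
      using ones_subset[of "str v"] str[of v] str[of w] v w assms
      by (intro elem_G_lex_greater) auto
    then show ?thesis using str w by simp
  qed simp
  then have "(\<Sum>w\<in>T - {v}. c w * w A) = 0"
    by (intro sum.neutral ballI)
  then have "(\<Sum>w\<in>T. c w * w A) = c v * v A"
    using T(2) v(1) by (simp add: sum.remove[of T v])
  moreover have "(\<Sum>w\<in>T. c w * w A) = 0"
    using fun_cong[OF T(3), of A] by (simp add: ext_sum_apply ext_scale_def)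
  moreover have "v A = 1" using elem_G_leading[of "str v"] str[of v] v by simp
  ultimately show False using v(2) by simp
qed


section \<open>Functionals from noncrossing matchings\<close>

text \<open>Arcs join opening positions \<open>m b\<close> to closing positions \<open>b\<close>;
  the last clause forbids crossings.\<close>

definition nc_matching :: "nat set \<Rightarrow> (nat \<Rightarrow> nat) \<Rightarrow> bool" where
  "nc_matching S m \<longleftrightarrow> inj_on m S \<and> m ` S \<inter> S = {} \<and> (\<forall>b\<in>S. m b < b) \<and>
     (\<forall>b\<in>S. \<forall>c\<in>S. m b < c \<and> c < b \<longleftrightarrow> m b < m c \<and> m c < b)"

text \<open>Greedy matching of parentheses: each new 1 takes the latest free position, which the
  ballot condition provides. The last clause leaves no free position under an arc, and so prevents
  the next arc from crossing an old one.\<close>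

lemma ballot_matching:
  assumes "\<not> breaks_ballot \<alpha>"
  shows "\<exists>m. nc_matching (ones \<alpha>) m \<and> m ` ones \<alpha> \<subseteq> {1..length \<alpha>} \<and>
           (\<forall>b\<in>ones \<alpha>. {m b<..<b} \<subseteq> ones \<alpha> \<union> m ` ones \<alpha>)"
  using assms
proof (induction \<alpha> rule: rev_induct)
  case Nil
  show ?case by (simp add: nc_matching_def)
next
  case (snoc x u)
  define S where "S = ones u"
  from snoc obtain m where m: "nc_matching S m" "m ` S \<subseteq> {1..length u}"
    "\<And>b. b \<in> S \<Longrightarrow> {m b<..<b} \<subseteq> S \<union> m ` S"
    by (auto simp: breaks_ballot_snoc S_def)
  have S: "finite S" "S \<subseteq> {1..length u}" using ones_subset[of u] by (auto simp: S_def)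
  show ?case
  proof (cases x)
    case False
    have "m ` S \<subseteq> {1..length (u @ [x])}" using m(2) by auto
    then show ?thesis using False m unfolding ones_snoc by (intro exI[of _ m]) (auto simp: S_def)
  next
    case True
    define k where "k = length u + 1"
    \<comment> \<open>The free positions; the latest of them, \<open>a\<close>, is to be matched
      with the new position \<open>k\<close>.\<close>
    define F where "F = {1..length u} - (S \<union> m ` S)"
    define a where "a = Max F"
    \<comment> \<open>The ballot inequality yields \<open>2 * card S < length u\<close>, while the
      old arcs occupy at most \<open>2 * card S\<close> positions.\<close>
    have "2 * m1 (u @ [True]) \<le> length u + 1"
      using not_breaks_ballotD[OF snoc.prems] True by simp
    then have "card S + card S < length u" by (simp add: S_def card_ones)
    moreover have "card (S \<union> m ` S) \<le> card S + card S"
      using card_Un_le[of S "m ` S"] card_image_le[OF S(1), of m] by linarith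
    ultimately have "card F > 0"
      unfolding F_def using S m(2) by (subst card_Diff_subset) auto
    then have "F \<noteq> {}" by auto
    moreover have "finite F" by (simp add: F_def)
    ultimately have aF: "a \<in> F" and amax: "\<And>y. y \<in> F \<Longrightarrow> y \<le> a" by (simp_all add: a_def)
    have a: "1 \<le> a" "a < k" "a \<notin> S" "a \<notin> m ` S" using aF by (auto simp: F_def k_def)
    have kS: "k \<notin> S" "k \<notin> m ` S" "\<And>b. b \<in> S \<Longrightarrow> b < k" "\<And>b. b \<in> S \<Longrightarrow> m b < k"
      using S(2) m(2) by (auto simp: k_def image_subset_iff less_Suc_eq_le)
    have cover: "a \<notin> {m b<..<b}" if "b \<in> S" for b
      using m(3)[OF that] a by blast
    have nc: "inj_on m S" "m ` S \<inter> S = {}" "\<And>b. b \<in> S \<Longrightarrow> m b < b"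
      "\<And>b c. b \<in> S \<Longrightarrow> c \<in> S \<Longrightarrow> m b < c \<and> c < b \<longleftrightarrow> m b < m c \<and> m c < b"
      using m(1) unfolding nc_matching_def by blast+
    let ?m = "m(k := a)"
    have mS: "?m b = m b" if "b \<in> S" for b using that kS(1) by auto
    have im: "?m ` insert k S = insert a (m ` S)"
      by (simp only: image_insert fun_upd_same image_cong[OF refl mS])
    have "inj_on ?m (insert k S)"
      using nc(1) a(4) mS kS(1) by (auto simp: inj_on_def)
    moreover have "?m ` insert k S \<inter> insert k S = {}"
      unfolding im using nc(2) a kS by auto
    moreover have "?m b < b" if "b \<in> insert k S" for b
      using that nc(3) mS a(2) by auto
    moreover have "?m b < c \<and> c < b \<longleftrightarrow> ?m b < ?m c \<and> ?m c < b"
      if bc: "b \<in> insert k S" "c \<in> insert k S" for b c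
    proof -
      \<comment> \<open>No old arc passes over \<open>a\<close>, so both its ends lie on the same
        side of \<open>a\<close>.\<close>
      have arc: "a < c \<longleftrightarrow> a < m c" if "c \<in> S" for c
      proof -
        have "a \<noteq> m c" using a(4) that by blast
        then show ?thesis using cover[OF that] nc(3)[OF that] by force
      qed
      consider "b = k" "c = k" | "b = k" "c \<in> S" | "b \<in> S" "c = k" | "b \<in> S" "c \<in> S"
        using bc by blast
      then show ?thesis
      proof cases
        case 2
        then show ?thesis using arc[of c] mS kS(3,4) by auto
      next
        case 3
        then show ?thesis using cover[of b] mS kS(3)[of b] by auto
      next
        case 4
        then show ?thesis using nc(4) mS by simp
      qed simp
    qed
    ultimately have "nc_matching (insert k S) ?m"
      unfolding nc_matching_def by blast
    moreover have "insert a (m ` S) \<subseteq> {1..length (u @ [x])}"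
      using m(2) a by (auto simp: k_def)
    moreover have "{?m b<..<b} \<subseteq> insert k S \<union> insert a (m ` S)" if "b \<in> insert k S" for b
    proof (cases "b = k")
      case True
      show ?thesis
      proof
        fix y assume "y \<in> {?m b<..<b}"
        then have "a < y" "y < k" using True by auto
        \<comment> \<open>By maximality of \<open>a\<close> nothing under the new arc is free, which
          preserves the last clause.\<close>
        then have "y \<notin> F" "y \<in> {1..length u}" using amax[of y] by (auto simp: k_def)
        then show "y \<in> insert k S \<union> insert a (m ` S)" by (auto simp: F_def)
      qed
    next
      case False
      then have "b \<in> S" using that by blast
      then show ?thesis using m(3)[of b] mS by auto
    qed
    moreover have "ones (u @ [x]) = insert k S"
      using True by (simp add: ones_snoc k_def S_def)
    ultimately show ?thesis using im by metis
  qed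
qed

section \<open>Transversals of the arcs and their signed sums\<close>

text \<open>For a matching, these are the monomials obtained by picking one term from each
  difference.\<close>

definition transversals :: "nat set \<Rightarrow> (nat \<Rightarrow> nat) \<Rightarrow> nat set set" where
  "transversals S m = {A. A \<subseteq> S \<union> m ` S \<and> (\<forall>b\<in>S. b \<in> A \<longleftrightarrow> m b \<notin> A)}"

text \<open>Up to sign, the weight of \<open>A\<close> is the coefficient of \<open>\<theta>\<^sub>A\<close> in the product of the
  differences \<open>\<theta>\<^bsub>m b\<^esub> - \<theta>\<^sub>b\<close> over \<open>b \<in> S\<close>, the sign coming from sorting the chosen factors.\<close>

definition weight :: "nat set \<Rightarrow> (nat \<Rightarrow> nat) \<Rightarrow> nat set \<Rightarrow> rat" where
  "weight S m A = (\<Prod>b\<in>S \<inter> A. - ((- 1) ^ card (S \<inter> {m b<..<b})))"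

text \<open>Up to a global sign, the inner product of \<open>f\<close> with the product of the
  differences, the monomials being orthonormal.\<close>

definition pairing :: "nat set \<Rightarrow> (nat \<Rightarrow> nat) \<Rightarrow> ext \<Rightarrow> rat" where
  "pairing S m f = (\<Sum>A\<in>transversals S m. weight S m A * f A)"

lemma finite_transversals: "finite S \<Longrightarrow> finite (transversals S m)"
  by (rule finite_subset[of _ "Pow (S \<union> m ` S)"]) (auto simp: transversals_def)

text \<open>By noncrossing, an arc has both ends or no end strictly under the arc of
  \<open>b\<close>, and \<open>A\<close> and \<open>S\<close> each take exactly one of its
  ends.\<close>

lemma card_transversal_between:
  assumes "nc_matching S m" "A \<in> transversals S m" "b \<in> S"
  shows "card (A \<inter> {m b<..<b}) = card (S \<inter> {m b<..<b})"
proof -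
  \<comment> \<open>\<open>?h\<close> sends a closing position to the end of its arc that lies in
    \<open>A\<close>.\<close>
  let ?I = "{m b<..<b}" and ?h = "\<lambda>c. if c \<in> A then c else m c"
  have nc: "inj_on m S" "m ` S \<inter> S = {}" "\<And>c. c \<in> S \<Longrightarrow> c \<in> ?I \<longleftrightarrow> m c \<in> ?I"
    using assms(1,3) unfolding nc_matching_def by auto
  have A: "A \<subseteq> S \<union> m ` S" "\<And>c. c \<in> S \<Longrightarrow> c \<in> A \<longleftrightarrow> m c \<notin> A"
    using assms(2) by (auto simp: transversals_def)
  have "inj_on ?h (S \<inter> ?I)"
  proof (rule inj_onI)
    fix c d assume cd: "c \<in> S \<inter> ?I" "d \<in> S \<inter> ?I" "?h c = ?h d"
    have "m c \<notin> S" "m d \<notin> S" using cd nc(2) by auto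
    then show "c = d" using cd inj_onD[OF nc(1), of c d] by (auto split: if_splits)
  qed
  moreover have "?h ` (S \<inter> ?I) = A \<inter> ?I"
  proof (intro equalityI subsetI)
    fix y assume "y \<in> ?h ` (S \<inter> ?I)"
    then obtain c where c: "c \<in> S" "c \<in> ?I" "y = ?h c" by blast
    then show "y \<in> A \<inter> ?I" using nc(3)[of c] A(2)[of c] by (cases "c \<in> A") auto
  next
    fix y assume y: "y \<in> A \<inter> ?I"
    then consider "y \<in> S" | c where "c \<in> S" "y = m c" using A(1) by blast
    then show "y \<in> ?h ` (S \<inter> ?I)"
    proof cases
      case 1
      then show ?thesis using y by (intro image_eqI[of _ _ y]) auto
    next
      case 2
      then have "c \<notin> A" "c \<in> ?I" using A(2)[of c] nc(3)[of c] y by auto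
      then show ?thesis using 2 by (intro image_eqI[of _ _ c]) auto
    qed
  qed
  ultimately show ?thesis by (metis card_image)
qed

lemma transversal_swap:
  assumes "nc_matching S m" "A \<in> transversals S m" "b \<in> S"
  shows "insert b (A - {m b}) \<in> transversals S m" "insert (m b) (A - {b}) \<in> transversals S m"
proof -
  have A: "A \<subseteq> S \<union> m ` S" "\<And>c. c \<in> S \<Longrightarrow> c \<in> A \<longleftrightarrow> m c \<notin> A"
    using assms(2) by (auto simp: transversals_def)
  have ne: "c \<noteq> m b" "m c \<noteq> b" if "c \<in> S" for c
    using that assms(1,3) by (auto simp: nc_matching_def)
  have inj: "m c \<noteq> m b" if "c \<in> S" "c \<noteq> b" for c
    using that assms(1,3) by (auto simp: nc_matching_def inj_on_def)
  have "c \<in> insert b (A - {m b}) \<longleftrightarrow> m c \<notin> insert b (A - {m b})" if "c \<in> S" for c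
    using A(2)[OF that] ne[OF that] inj[OF that] by (cases "c = b") auto
  then show "insert b (A - {m b}) \<in> transversals S m"
    using A(1) assms(3) by (auto simp: transversals_def)
  have "c \<in> insert (m b) (A - {b}) \<longleftrightarrow> m c \<notin> insert (m b) (A - {b})" if "c \<in> S" for c
    using A(2)[OF that] ne[OF that] inj[OF that] by (cases "c = b") auto
  then show "insert (m b) (A - {b}) \<in> transversals S m"
    using A(1) assms(3) by (auto simp: transversals_def)
qed

text \<open>Minimality of \<open>b\<close> means that \<open>A\<close> and \<open>B\<close> agree strictly between \<open>m b\<close> and \<open>b\<close>, so the sign
  changes of the weight and of \<open>\<epsilon>(B, A - B)\<close> cancel, up to the sign from \<open>- \<theta>\<^sub>b\<close>.\<close>

lemma weight_swap:
  assumes "finite S" "nc_matching S m" "A \<in> transversals S m" "B \<subseteq> A"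
    and b: "b \<in> S" "b \<notin> B" "m b \<notin> B" "m b \<in> A"
    and least: "\<And>c. c \<in> S \<Longrightarrow> c \<notin> B \<Longrightarrow> m c \<notin> B \<Longrightarrow> b \<le> c"
  shows "weight S m (insert b (A - {m b})) * ext_sign B (insert b (A - {m b}) - B)
         = - (weight S m A * ext_sign B (A - B))"
proof -
  let ?I = "{m b<..<b}"
  define D where "D = A - B - {m b}"
  have A: "A \<subseteq> S \<union> m ` S" "\<And>c. c \<in> S \<Longrightarrow> c \<in> A \<longleftrightarrow> m c \<notin> A"
    using assms(3) by (auto simp: transversals_def)
  have fin: "finite A" "finite B" "finite D"
    using finite_subset[OF A(1)] assms(1,4) finite_subset[of B A] by (auto simp: D_def)
  have lt: "m b < b" and mb: "m b \<notin> S" and bA: "b \<notin> A"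
    using assms(2) b A(2)[of b] by (auto simp: nc_matching_def)
  have AB: "A - B = insert (m b) D" "insert b (A - {m b}) - B = insert b D"
    using b by (auto simp: D_def)
  have notD: "m b \<notin> D" "b \<notin> D" using bA by (auto simp: D_def)
  \<comment> \<open>An element of \<open>A\<close> under the arc of \<open>b\<close> but outside
    \<open>B\<close> would lie on an arc avoiding \<open>B\<close>, since its other end is outside
    \<open>A\<close>. By noncrossing that arc closes before \<open>b\<close>, against
    minimality.\<close>
  have "B \<inter> ?I = A \<inter> ?I"
  proof (intro equalityI subsetI)
    fix y assume y: "y \<in> A \<inter> ?I"
    show "y \<in> B \<inter> ?I"
    proof (rule ccontr)
      assume "y \<notin> B \<inter> ?I"
      then have "y \<notin> B" using y by blast
      from y A(1) consider "y \<in> S" | c where "c \<in> S" "y = m c" by blast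
      then obtain c where c: "c \<in> S" "c \<notin> B" "m c \<notin> B" "c \<in> ?I"
      proof cases
        case 1
        then have "m y \<notin> B" using A(2)[of y] y assms(4) by blast
        then show ?thesis using that 1 y \<open>y \<notin> B\<close> by blast
      next
        case 2
        then have "c \<notin> B" using A(2)[of c] y assms(4) by blast
        moreover have "c \<in> ?I" using assms(2) b(1) 2 y by (auto simp: nc_matching_def)
        ultimately show ?thesis using that 2 \<open>y \<notin> B\<close> by blast
      qed
      then show False using least[of c] by auto
    qed
  qed (use assms(4) in blast)
  then have card_I: "card (B \<inter> ?I) = card (S \<inter> ?I)"
    using card_transversal_between[OF assms(2,3) b(1)] by simp
  \<comment> \<open>The inversions of \<open>B\<close> with \<open>m b\<close> and with
    \<open>b\<close> differ by the elements of \<open>B\<close> under the arc.\<close>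
  have "{x \<in> B. m b < x} = (B \<inter> ?I) \<union> {x \<in> B. b < x}"
    using lt b(2) by (auto simp: not_less_iff_gr_or_eq)
  moreover have "(B \<inter> ?I) \<inter> {x \<in> B. b < x} = {}" by auto
  ultimately have "card {x \<in> B. m b < x} = card (S \<inter> ?I) + card {x \<in> B. b < x}"
    using fin(2) by (simp add: card_Un_disjoint card_I)
  then have "ext_sign B {m b} = (- 1) ^ card (S \<inter> ?I) * ext_sign B {b}"
    by (simp add: ext_sign_singleton_right power_add)
  moreover have "ext_sign B (insert c D) = ext_sign B {c} * ext_sign B D" if "c \<notin> D" for c
    using ext_sign_Un_right[of B "{c}" D] fin that by simp
  ultimately have sign: "ext_sign B (A - B) = (- 1) ^ card (S \<inter> ?I) * ext_sign B (insert b D)"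
    using notD AB(1) by simp
  have "S \<inter> insert b (A - {m b}) = insert b (S \<inter> A)" using b(1) mb by auto
  then have "weight S m (insert b (A - {m b})) = - ((- 1) ^ card (S \<inter> ?I)) * weight S m A"
    using bA fin(1) by (simp add: weight_def)
  then show ?thesis unfolding AB(2) sign by simp
qed

text \<open>The involution exchanges the ends of an arc that avoids \<open>B\<close>. The arc is
  selected from \<open>B\<close> alone, so the same exchange serves every \<open>A\<close>; since
  \<open>r\<close> is positive, it exists whenever the sum has a term.\<close>

lemma sum_weight_eq_0:
  assumes "finite S" "nc_matching S m" "1 \<le> r"
  shows "(\<Sum>A | A \<in> transversals S m \<and> B \<subseteq> A \<and> card (A - B) = r.
            weight S m A * ext_sign B (A - B)) = 0"
proof -
  let ?U = "{A. A \<in> transversals S m \<and> B \<subseteq> A \<and> card (A - B) = r}"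
  let ?g = "\<lambda>A. weight S m A * ext_sign B (A - B)"
  have finU: "finite ?U" using finite_transversals[OF assms(1)] by simp
  show ?thesis
  proof (cases "?U = {}")
    case True
    then show ?thesis by (simp only: sum.empty)
  next
    case False
    then obtain A where A: "A \<in> transversals S m" "B \<subseteq> A" "card (A - B) = r" by blast
    then have "A - B \<noteq> {}" using assms(3) by (metis card.empty not_one_le_zero)
    then obtain y where y: "y \<in> A" "y \<notin> B" by blast
    \<comment> \<open>The other end of the arc through \<open>y\<close> is outside \<open>A\<close>,
      hence outside \<open>B\<close>.\<close>
    have "\<exists>c. c \<in> S \<and> c \<notin> B \<and> m c \<notin> B"
    proof -
      have "y \<in> S \<or> (\<exists>c\<in>S. y = m c)" "\<And>c. c \<in> S \<Longrightarrow> c \<in> A \<longleftrightarrow> m c \<notin> A"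
        using A(1) y(1) by (auto simp: transversals_def)
      then show ?thesis using y A(2) by blast
    qed
    then obtain b where b: "b \<in> S" "b \<notin> B" "m b \<notin> B"
      and least: "\<And>c. c \<in> S \<Longrightarrow> c \<notin> B \<Longrightarrow> m c \<notin> B \<Longrightarrow> b \<le> c"
      using exists_least_iff[of "\<lambda>c. c \<in> S \<and> c \<notin> B \<and> m c \<notin> B"] by (metis not_le)
    have mb: "m b \<noteq> b" using assms(2) b(1) by (auto simp: nc_matching_def)
    have either: "b \<in> A \<longleftrightarrow> m b \<notin> A" if "A \<in> ?U" for A
      using that b(1) by (auto simp: transversals_def)
    have finA: "finite A" if "A \<in> ?U" for A
      using that assms(1) finite_subset[of A "S \<union> m ` S"] by (auto simp: transversals_def)
    have card_swap: "card (insert c (A - {d}) - B) = card (A - B)"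
      if "A \<in> ?U" "c \<notin> A" "d \<in> A" "c \<notin> B" "d \<notin> B" for A c d
    proof -
      have "insert c (A - {d}) - B = insert c (A - B - {d})" using that by auto
      moreover have "card (insert c (A - B - {d})) = Suc (card (A - B - {d}))"
        using finA[OF that(1)] that(2) by (subst card_insert_disjoint) auto
      moreover have "Suc (card (A - B - {d})) = card (A - B)"
        using finA[OF that(1)] that by (intro card_Suc_Diff1) auto
      ultimately show ?thesis by simp
    qed
    have "(\<Sum>A\<in>{A \<in> ?U. b \<in> A}. ?g A) = (\<Sum>A\<in>{A \<in> ?U. m b \<in> A}. - ?g A)"
    proof (rule sum.reindex_bij_witness[where i = "\<lambda>A. insert b (A - {m b})" and
          j = "\<lambda>A. insert (m b) (A - {b})"], goal_cases)
      case (1 A)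
      then show ?case using either[of A] by auto
    next
      case (2 A)
      then have "insert (m b) (A - {b}) \<in> transversals S m" "B \<subseteq> insert (m b) (A - {b})"
        using transversal_swap(2)[OF assms(2) _ b(1)] b(2) by auto
      then show ?case using 2 card_swap[of A "m b" b] either[of A] b by simp
    next
      case (3 A)
      then show ?case using either[of A] by auto
    next
      case (4 A)
      then have "insert b (A - {m b}) \<in> transversals S m" "B \<subseteq> insert b (A - {m b})"
        using transversal_swap(1)[OF assms(2) _ b(1)] b(3) by auto
      then show ?case using 4 card_swap[of A b "m b"] either[of A] b by simp
    next
      case (5 A)
      let ?A = "insert (m b) (A - {b})"
      have swap_back: "insert b (?A - {m b}) = A" using 5 either[of A] mb by auto
      have "?A \<in> transversals S m" "B \<subseteq> ?A"
        using 5 transversal_swap(2)[OF assms(2) _ b(1)] b(2) by auto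
      from weight_swap[OF assms(1,2) this b _ least] show ?case
        unfolding swap_back by simp
    qed
    moreover have "?U = {A \<in> ?U. b \<in> A} \<union> {A \<in> ?U. m b \<in> A}" using either by blast
    moreover have "{A \<in> ?U. b \<in> A} \<inter> {A \<in> ?U. m b \<in> A} = {}" using either by blast
    ultimately have "sum ?g ?U = (\<Sum>A\<in>{A \<in> ?U. m b \<in> A}. - ?g A) + sum ?g {A \<in> ?U. m b \<in> A}"
      using finU by (metis (mono_tags, lifting) finite_Un sum.union_disjoint)
    then show ?thesis by (simp add: sum_negf)
  qed
qed

text \<open>After exchanging summations, \<open>x B\<close> is multiplied by a signed sum that
  vanishes by \<open>sum_weight_eq_0\<close>.\<close>

lemma pairing_mult_elem_F:
  assumes "finite S" "nc_matching S m" "S \<union> m ` S \<subseteq> {1..n}" "1 \<le> r"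
  shows "pairing S m (x \<^bold>* elem_F n r) = 0"
proof -
  let ?E = "S \<union> m ` S" and ?T = "transversals S m"
  have fin: "finite ?T" "finite (Pow ?E)" using finite_transversals assms(1) by auto
  have "pairing S m (x \<^bold>* elem_F n r) = (\<Sum>A\<in>?T. \<Sum>B\<in>Pow ?E.
      x B * (if B \<subseteq> A \<and> card (A - B) = r then weight S m A * ext_sign B (A - B) else 0))"
    unfolding pairing_def
  proof (rule sum.cong[OF refl])
    fix A assume "A \<in> ?T"
    then have AE: "A \<subseteq> ?E" by (simp add: transversals_def)
    then have AP: "Pow A \<subseteq> Pow ?E" by blast
    have "weight S m A * (x \<^bold>* elem_F n r) A = (\<Sum>B\<in>Pow A.
        x B * (if B \<subseteq> A \<and> card (A - B) = r then weight S m A * ext_sign B (A - B) else 0))"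
      unfolding ext_mult_def sum_distrib_left
    proof (rule sum.cong[OF refl])
      fix B assume "B \<in> Pow A"
      moreover have "A - B \<subseteq> {1..n}" using AE assms(3) by blast
      ultimately show "weight S m A * (ext_sign B (A - B) * x B * elem_F n r (A - B))
        = x B * (if B \<subseteq> A \<and> card (A - B) = r then weight S m A * ext_sign B (A - B) else 0)"
        by (simp add: elem_F_apply)
    qed
    \<comment> \<open>Enlarging the range to one independent of \<open>A\<close> permits the
      exchange of sums.\<close>
    also have "\<dots> = (\<Sum>B\<in>Pow ?E.
        x B * (if B \<subseteq> A \<and> card (A - B) = r then weight S m A * ext_sign B (A - B) else 0))"
      using fin(2) AP by (intro sum.mono_neutral_left) auto
    finally show "weight S m A * (x \<^bold>* elem_F n r) A = \<dots>" .
  qed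
  also have "\<dots> = (\<Sum>B\<in>Pow ?E. \<Sum>A\<in>?T.
      x B * (if B \<subseteq> A \<and> card (A - B) = r then weight S m A * ext_sign B (A - B) else 0))"
    by (rule sum.swap)
  also have "\<dots> = (\<Sum>B\<in>Pow ?E. x B * 0)"
  proof (rule sum.cong[OF refl])
    fix B
    have "(\<Sum>A\<in>?T. if B \<subseteq> A \<and> card (A - B) = r then weight S m A * ext_sign B (A - B) else 0) = 0"
      using sum_weight_eq_0[OF assms(1,2,4), of B] fin(1)
      by (simp add: sum.inter_filter[symmetric])
    then show "(\<Sum>A\<in>?T. x B * (if B \<subseteq> A \<and> card (A - B) = r then weight S m A * ext_sign B (A - B) else 0)) = x B * 0"
      by (simp only: sum_distrib_left[symmetric])
  qed
  finally show ?thesis by simp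
qed

lemma pairing_add: "pairing S m (f + g) = pairing S m f + pairing S m g"
  by (simp add: pairing_def distrib_left sum.distrib)

text \<open>The kernel of the functional is not evidently an ideal, but the elements all of whose
  two-sided multiples lie in the kernel form one, \<open>?J\<close>. It suffices that
  \<open>?J\<close> contains the generators.\<close>

lemma pairing_ideal_I:
  assumes "finite S" "nc_matching S m" "S \<union> m ` S \<subseteq> {1..n}" "f \<in> ideal_I n"
  shows "pairing S m f = 0"
proof -
  define R where "R = ext_ring n"
  interpret R: ring R unfolding R_def by (rule ring_ext_ring)
  let ?J = "{f \<in> carrier R. \<forall>g\<in>carrier R. \<forall>h\<in>carrier R. pairing S m (g \<otimes>\<^bsub>R\<^esub> f \<otimes>\<^bsub>R\<^esub> h) = 0}"
  have mult: "f \<otimes>\<^bsub>R\<^esub> g = f \<^bold>* g" for f g by (simp add: R_def ext_ring_def)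
  have add: "pairing S m (f \<oplus>\<^bsub>R\<^esub> g) = pairing S m f + pairing S m g" for f g
    using pairing_add[of S m f g] by (simp add: R_def ext_ring_def)
  have zero: "pairing S m \<zero>\<^bsub>R\<^esub> = 0" by (simp add: R_def ext_ring_def pairing_def)
  have minus: "pairing S m (\<ominus>\<^bsub>R\<^esub> f) = - pairing S m f" if "f \<in> carrier R" for f
    using add[of f "\<ominus>\<^bsub>R\<^esub> f"] zero R.r_neg[OF that] by simp
  have "ideal ?J R"
  proof (rule idealI[OF R.ring_axioms])
    have "a \<ominus>\<^bsub>R\<^esub> b \<in> ?J" if "a \<in> ?J" "b \<in> ?J" for a b
    proof -
      have "g \<otimes>\<^bsub>R\<^esub> (a \<ominus>\<^bsub>R\<^esub> b) \<otimes>\<^bsub>R\<^esub> h = (g \<otimes>\<^bsub>R\<^esub> a \<otimes>\<^bsub>R\<^esub> h) \<oplus>\<^bsub>R\<^esub> \<ominus>\<^bsub>R\<^esub> (g \<otimes>\<^bsub>R\<^esub> b \<otimes>\<^bsub>R\<^esub> h)"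
        if "g \<in> carrier R" "h \<in> carrier R" for g h
        using that \<open>a \<in> ?J\<close> \<open>b \<in> ?J\<close>
        by (simp add: R.minus_eq R.l_distr R.r_distr R.l_minus R.r_minus)
      then show ?thesis using that by (simp add: add minus)
    qed
    moreover have zJ: "\<zero>\<^bsub>R\<^esub> \<in> ?J" by (simp add: zero)
    ultimately have diff: "a \<ominus>\<^bsub>R\<^esub> b \<in> ?J" if "a \<in> ?J" "b \<in> ?J" for a b using that by blast
    have neg: "\<ominus>\<^bsub>R\<^esub> b \<in> ?J" if "b \<in> ?J" for b
      using diff[OF zJ that] that by (simp add: R.minus_eq)
    have plus: "a \<oplus>\<^bsub>R\<^esub> b \<in> ?J" if "a \<in> ?J" "b \<in> ?J" for a b
      using diff[OF that(1) neg[OF that(2)]] that by (simp add: R.minus_eq)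
    show "subgroup ?J (add_monoid R)"
    proof (rule group.subgroupI[OF R.a_group])
      show "?J \<noteq> {}" using zJ by blast
      show "inv\<^bsub>add_monoid R\<^esub> a \<in> ?J" if "a \<in> ?J" for a
        using neg[OF that] by (simp only: a_inv_def)
      show "a \<otimes>\<^bsub>add_monoid R\<^esub> b \<in> ?J" if "a \<in> ?J" "b \<in> ?J" for a b
        using plus[OF that] by simp
    qed auto
  next
    fix a x assume ax: "a \<in> ?J" "x \<in> carrier R"
    have "g \<otimes>\<^bsub>R\<^esub> (x \<otimes>\<^bsub>R\<^esub> a) \<otimes>\<^bsub>R\<^esub> h = (g \<otimes>\<^bsub>R\<^esub> x) \<otimes>\<^bsub>R\<^esub> a \<otimes>\<^bsub>R\<^esub> h"
      "g \<otimes>\<^bsub>R\<^esub> (a \<otimes>\<^bsub>R\<^esub> x) \<otimes>\<^bsub>R\<^esub> h = g \<otimes>\<^bsub>R\<^esub> a \<otimes>\<^bsub>R\<^esub> (x \<otimes>\<^bsub>R\<^esub> h)"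
      if "g \<in> carrier R" "h \<in> carrier R" for g h
      using that ax by (simp_all add: R.m_assoc)
    then show "x \<otimes>\<^bsub>R\<^esub> a \<in> ?J" "a \<otimes>\<^bsub>R\<^esub> x \<in> ?J" using ax by simp_all
  qed
  moreover have "elem_F n r \<in> ?J" if "1 \<le> r" for r
  proof -
    have "pairing S m (g \<otimes>\<^bsub>R\<^esub> elem_F n r \<otimes>\<^bsub>R\<^esub> h) = 0" for g h
    proof -
      \<comment> \<open>The factor \<open>h\<close> crosses the generator at the cost of a sign
        twist, leaving a left multiple.\<close>
      have "g \<^bold>* elem_F n r \<^bold>* h = (g \<^bold>* (\<lambda>A. (- 1) ^ (r * card A) * h A)) \<^bold>* elem_F n r"
        by (simp only: ext_mult_assoc elem_F_mult_commute)
      then show ?thesis unfolding mult using pairing_mult_elem_F[OF assms(1-3) that] by simp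
    qed
    then show ?thesis using elem_F_carrier[of n r] by (simp add: R_def)
  qed
  ultimately have "ideal_I n \<subseteq> ?J"
    unfolding ideal_I_def R_def[symmetric] by (intro R.genideal_minimal) auto
  then have f: "f \<in> ?J" using assms(4) by blast
  then have "pairing S m (\<one>\<^bsub>R\<^esub> \<otimes>\<^bsub>R\<^esub> f \<otimes>\<^bsub>R\<^esub> \<one>\<^bsub>R\<^esub>) = 0" by blast
  then show ?thesis using f by simp
qed

section \<open>Vanishing criterion and spanning\<close>

text \<open>A transversal departs from \<open>S\<close> only by trading some \<open>b\<close> for
  the smaller \<open>m b\<close>, which is not in \<open>S\<close>.\<close>

lemma transversal_lex_greater:
  assumes "nc_matching S m" "A \<in> transversals S m" "A \<noteq> S"
  shows "lex_greater A S"
proof (rule ccontr)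
  assume "\<not> lex_greater A S"
  then have "lex_greater S A" using lex_greater_linear[OF assms(3)] by blast
  then obtain x where x: "x \<in> S" "x \<notin> A" "\<forall>y<x. y \<in> S \<longleftrightarrow> y \<in> A"
    unfolding lex_greater_def by blast
  then have "m x \<in> A" "m x \<notin> S" "m x < x"
    using assms(1,2) by (auto simp: transversals_def nc_matching_def)
  with x(3) show False by blast
qed

lemma ideal_I_eq_0:
  assumes "f \<in> ideal_I n"
    and breaking: "\<And>\<alpha>. length \<alpha> = n \<Longrightarrow> breaks_ballot \<alpha> \<Longrightarrow> f (ones \<alpha>) = 0"
  shows "f = 0"
proof (rule ccontr)
  assume "f \<noteq> 0"
  let ?X = "{A. f A \<noteq> 0}"
  have sub: "?X \<subseteq> Pow {1..n}" using ideal_I_carrier[OF assms(1)] by (auto simp: ext_ring_def)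
  have "finite ?X" by (rule finite_subset[OF sub]) simp
  moreover have "?X \<noteq> {}" using \<open>f \<noteq> 0\<close> by (auto simp: fun_eq_iff)
  ultimately obtain S where S: "S \<in> ?X" "\<forall>B\<in>?X. B \<noteq> S \<longrightarrow> lex_greater S B"
    by (rule lex_max_exists)
  then have Sn: "S \<subseteq> {1..n}" using sub by blast
  then obtain \<alpha> where \<alpha>: "length \<alpha> = n" "ones \<alpha> = S" by (rule ones_surj)
  have "\<not> breaks_ballot \<alpha>" using breaking[OF \<alpha>(1)] S(1) \<alpha>(2) by auto
  from ballot_matching[OF this] obtain m where m: "nc_matching S m" "m ` S \<subseteq> {1..n}"
    unfolding \<alpha> by blast
  have fin: "finite S" using Sn finite_subset by blast
  \<comment> \<open>\<open>f\<close> vanishes at every set above its leading set \<open>S\<close>,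
    so only the term at \<open>S\<close> remains, and its weight is a sign.\<close>
  have "weight S m A * f A = 0" if "A \<in> transversals S m - {S}" for A
  proof -
    have "lex_greater A S" using transversal_lex_greater[OF m(1)] that by blast
    then have "\<not> lex_greater S A" "A \<noteq> S" using lex_greater_trans lex_greater_irrefl by blast+
    then have "f A = 0" using S(2) by blast
    then show ?thesis by simp
  qed
  then have "(\<Sum>A\<in>transversals S m - {S}. weight S m A * f A) = 0"
    by (intro sum.neutral ballI)
  moreover have "S \<in> transversals S m" using m(1) by (auto simp: transversals_def nc_matching_def)
  ultimately have "pairing S m f = weight S m S * f S"
    unfolding pairing_def using finite_transversals[OF fin] by (simp add: sum.remove[of _ S])
  moreover have "pairing S m f = 0" using pairing_ideal_I[OF fin m(1) _ assms(1)] Sn m(2) by blast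
  moreover have "weight S m S \<noteq> 0" using fin by (simp add: weight_def)
  ultimately show False using S(1) by simp
qed

text \<open>Elimination from the top: a multiple of some \<open>elem_G \<alpha>\<close> clears the
  greatest ballot-breaking coefficient, and once none is left \<open>ideal_I_eq_0\<close>
  applies.\<close>

lemma ideal_I_subset_span:
  assumes "f \<in> ideal_I n"
  shows "f \<in> ext.span (basis_A n)"
proof -
  define Br where "Br = ones ` {\<alpha>. length \<alpha> = n \<and> breaks_ballot \<alpha>}"
  \<comment> \<open>The termination measure counts the breaking sets up to the greatest one in the
    support of \<open>f\<close>; coefficients at other sets may change freely.\<close>
  define M :: "ext \<Rightarrow> nat set set" where
    "M f = {B \<in> Br. \<exists>A\<in>Br. f A \<noteq> 0 \<and> \<not> lex_greater B A}" for f
  have Br_sub: "Br \<subseteq> Pow {1..n}" using ones_subset by (force simp: Br_def)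
  have fin: "finite Br" by (rule finite_subset[OF Br_sub]) simp
  show ?thesis using assms
  proof (induction "card (M f)" arbitrary: f rule: less_induct)
    case less
    let ?X = "{A \<in> Br. f A \<noteq> 0}"
    show ?case
    proof (cases "?X = {}")
      case True
      then have "f = 0" using ideal_I_eq_0[OF less.prems] by (auto simp: Br_def)
      then show ?thesis by (simp only: ext.span_zero)
    next
      case False
      have "finite ?X" using fin by simp
      from this False obtain A where A: "A \<in> ?X" "\<forall>B\<in>?X. B \<noteq> A \<longrightarrow> lex_greater A B"
        by (rule lex_max_exists)
      then obtain \<alpha> where \<alpha>: "length \<alpha> = n" "breaks_ballot \<alpha>" "A = ones \<alpha>"
        by (auto simp: Br_def)
      let ?f = "f - f A *\<^sub>Q elem_G \<alpha>"
      have G: "elem_G \<alpha> \<in> ideal_I n" "elem_G \<alpha> \<in> ext.span (basis_A n)"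
        using elem_G_in_ideal_I[OF \<alpha>(2)] \<alpha> by (auto simp: basis_A_def intro: ext.span_base)
      have f': "?f \<in> ideal_I n"
        using less.prems G(1) subspace_ideal_I by (intro ext.subspace_diff ext.subspace_scale)
      \<comment> \<open>The coefficient at \<open>A\<close> cancels, and
        \<open>elem_G \<alpha>\<close> vanishes above \<open>A\<close>, so nothing reappears
        there.\<close>
      have lower: "lex_greater A B" if B: "B \<in> Br" "?f B \<noteq> 0" for B
      proof (rule ccontr)
        assume not: "\<not> lex_greater A B"
        have "?f A = 0" using elem_G_leading[of \<alpha>] \<alpha>(3) by (simp add: ext_scale_def)
        with B(2) have "B \<noteq> A" by auto
        then have "lex_greater B A" using not lex_greater_linear by blast
        then have "elem_G \<alpha> B = 0"
          using elem_G_lex_greater[of B \<alpha>] \<alpha> B(1) Br_sub by blast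
        moreover have "f B = 0" using A(2) B(1) not \<open>B \<noteq> A\<close> by blast
        ultimately show False using B(2) by (simp add: ext_scale_def)
      qed
      have "M ?f \<subseteq> M f"
      proof
        fix B assume "B \<in> M ?f"
        then obtain C where C: "B \<in> Br" "C \<in> Br" "?f C \<noteq> 0" "\<not> lex_greater B C"
          unfolding M_def by blast
        have "\<not> lex_greater B A" using lower[OF C(2,3)] C(4) lex_greater_trans by blast
        then show "B \<in> M f" using A(1) C(1) unfolding M_def by blast
      qed
      moreover have "A \<in> M f" using A(1) lex_greater_irrefl unfolding M_def by blast
      moreover have "A \<notin> M ?f" using lower unfolding M_def by blast
      ultimately have "M ?f \<subset> M f" by blast
      then have "card (M ?f) < card (M f)"
        using fin by (intro psubset_card_mono) (simp_all add: M_def)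
      then have "?f \<in> ext.span (basis_A n)" using less.hyps f' by blast
      then have "?f + f A *\<^sub>Q elem_G \<alpha> \<in> ext.span (basis_A n)"
        using G(2) by (intro ext.span_add ext.span_scale)
      then show ?thesis by simp
    qed
  qed
qed

theorem theorem4p2:
  fixes n :: nat
  assumes "n \<ge> 1"
  shows "ext.independent (basis_A n) \<and> ext.span (basis_A n) = ideal_I n"
proof
  have image: "basis_A n = elem_G ` {\<alpha>. length \<alpha> = n \<and> breaks_ballot \<alpha>}"
    by (auto simp: basis_A_def)
  show "ext.independent (basis_A n)"
    unfolding image by (rule independent_elem_G) simp
  have "basis_A n \<subseteq> ideal_I n"
    using elem_G_in_ideal_I by (auto simp: basis_A_def)
  then have "ext.span (basis_A n) \<subseteq> ideal_I n"
    using subspace_ideal_I by (rule ext.span_minimal)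
  then show "ext.span (basis_A n) = ideal_I n"
    using ideal_I_subset_span by blast
qed

end
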